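(* Let $G$ and $H$ be multiplicative Lie algebras acting compatibly on each other. If $H$ is Lie solvable of length $n$, then the quotient multiplicative Lie algebra $\dfrac{G\otimes H}{{}^L[H,G]\otimes\langle G,H\rangle}$ is also Lie solvable, of length $\le n+1$.
   Context: Multiplicative Lie algebra: a set $G$ with two binary operations $\cdot,\star$ such that $(G,\cdot)$ is a group (not necessarily abelian) and, for all $x,y,z\in G$, with ${}^zx:=zxz^{-1}$: $x\star x=1$; $x\star(yz)=(x\star y)\,{}^y(x\star z)$; $(xy)\star z={}^x(y\star z)\,(x\star z)$; $((x\star y)\star{}^yz)((y\star z)\star{}^zx)((z\star x)\star{}^xy)=1$; ${}^z(x\star y)={}^zx\star{}^zy$. Commutators are $[a,b]=aba^{-1}b^{-1}$. An ideal of $G$ is a normal subgroup $I$ with $g\star a\in I$ for all $g\in G$, $a\in I$; quotients by ideals are again multiplicative Lie algebras. Actions: multiplicative Lie algebras $G$ and $H$ act on each other if the underlying groups act on each other by group automorphisms (written ${}^xy\in H$ and ${}^yx\in G$ for $x\in G,y\in H$; within $G$ or within $H$ superscripts denote conjugation) together with a map $G\times H\to H$, $(x,y)\mapsto\langle x,y\rangle$, satisfying for $x,x'\in G$, $y,y'\in H$: $\langle x,yy'\rangle=\langle x,y\rangle\langle{}^yx,{}^yy'\rangle$; $\langle xx',y\rangle=\langle{}^xx',{}^xy\rangle\langle x,y\rangle$; $\langle x\star x',{}^{x'}y\rangle\,\langle{}^yx,\langle x',y\rangle\rangle^{-1}\langle{}^xx',\langle x,y\rangle^{-1}\rangle^{-1}=1$;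 $\langle{}^{y'}x,y\star y'\rangle\,\langle\langle y,x\rangle^{-1},{}^yy'\rangle^{-1}\langle\langle y',x\rangle,{}^xy\rangle^{-1}=1$; and a map $H\times G\to G$, $(y,x)\mapsto\langle y,x\rangle$, satisfying the same conditions with the roles of $G$ and $H$ exchanged. Superscripts that are products of elements of $G$ and $H$ mean successive action, e.g. ${}^{ghg^{-1}}g'={}^g({}^h({}^{g^{-1}}g'))$. The actions are compatible if for all $g,g'\in G$, $h,h'\in H$: (1) ${}^{({}^gh)}g'={}^{ghg^{-1}}g'$ and ${}^{({}^hg)}h'={}^{hgh^{-1}}h'$; (2) $\langle\langle h,g\rangle^{-1},h'\rangle=\langle g,h\rangle\star h'$ and $\langle\langle g,h\rangle^{-1},g'\rangle=\langle h,g\rangle\star g'$; (3) ${}^{\langle g,h\rangle\langle h,g\rangle}h'=h'$ and ${}^{\langle g,h\rangle\langle h,g\rangle}g'=g'$; (4) ${}^g\langle h,g'\rangle=\langle{}^gh,{}^gg'\rangle$ and ${}^h\langle g,h'\rangle=\langle{}^hg,{}^hh'\rangle$; (5) $\langle g\,{}^hg^{-1},h'\rangle=({}^ghh^{-1})\star h'$ and $\langle h\,{}^gh^{-1},g'\rangle=({}^hgg^{-1})\star g'$. Notation: ${}^L[h,g]=\langle h,g\rangle^{-1}({}^hg\,g^{-1})\in G$; ${}^L[H,G]$ is the subgroup of $G$ generated by all ${}^L[h,g]$ ($h\in H,g\in G$), an ideal of $G$; $\langle G,H\rangle$ is the subgroup of $H$ generated by all $\langle g,h\rangle$, an ideal of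 $H$. Tensor product: $G\otimes H$ is the multiplicative Lie algebra generated by symbols $x\otimes y$ ($x\in G,y\in H$) subject to, for all $x,x'\in G$, $y,y'\in H$: $x\otimes yy'=(x\otimes y)({}^yx\otimes{}^yy')$; $xx'\otimes y=({}^xx'\otimes{}^xy)(x\otimes y)$; $((x\star x')\otimes{}^{x'}y)({}^yx\otimes\langle x',y\rangle)^{-1}({}^xx'\otimes\langle x,y\rangle^{-1})^{-1}=1$; $({}^{y'}x\otimes(y\star y'))(\langle y,x\rangle^{-1}\otimes{}^yy')^{-1}(\langle y',x\rangle\otimes{}^xy)^{-1}=1$; $(x\otimes y)\star(x'\otimes y')=\langle y,x\rangle^{-1}\otimes\langle x',y'\rangle$. For ideals $I$ of $G$ and $J$ of $H$, $I\otimes J$ denotes the subgroup of $G\otimes H$ generated by the elements $a\otimes b$ with $a\in I$, $b\in J$; ${}^L[H,G]\otimes\langle G,H\rangle$ is meant in this sense and is treated as an ideal of $G\otimes H$. Lie solvability: for a multiplicative Lie algebra $K$ and $a,b\in K$ put ${}^L[a,b]=(a\star b)^{-1}[a,b]$; ${}^L[K,K]$ is the ideal of $K$ generated by all ${}^L[a,b]$, $a,b\in K$. Put $K^{(0)}=K$ and $K^{(k+1)}={}^L[K^{(k)},K^{(k)}]$. $K$ is Lie solvable if $K^{(n)}=\{1\}$ for some $n$; its length is the least such $n$. *)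

theory Defs
  imports "HOL-Algebra.Algebra"
begin

section \<open>Multiplicative Lie algebras\<close>

record 'a mla = "'a monoid" +
  lie_star :: "'a \<Rightarrow> 'a \<Rightarrow> 'a"  (infixl \<open>\<star>\<index>\<close> 70)

definition gconj :: "('a, 'm) monoid_scheme \<Rightarrow> 'a \<Rightarrow> 'a \<Rightarrow> 'a" where
  "gconj K z x = z \<otimes>\<^bsub>K\<^esub> x \<otimes>\<^bsub>K\<^esub> inv\<^bsub>K\<^esub> z"

definition gcomm :: "('a, 'm) monoid_scheme \<Rightarrow> 'a \<Rightarrow> 'a \<Rightarrow> 'a" where
  "gcomm K a b = a \<otimes>\<^bsub>K\<^esub> b \<otimes>\<^bsub>K\<^esub> inv\<^bsub>K\<^esub> a \<otimes>\<^bsub>K\<^esub> inv\<^bsub>K\<^esub> b"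

locale multiplicative_lie_algebra = group K for K :: "('a, 'm) mla_scheme" (structure) +
  assumes star_closed: "\<lbrakk>x \<in> carrier K; y \<in> carrier K\<rbrakk> \<Longrightarrow> x \<star> y \<in> carrier K"
    and star_self: "x \<in> carrier K \<Longrightarrow> x \<star> x = \<one>"
    and star_mult: "\<lbrakk>x \<in> carrier K; y \<in> carrier K; z \<in> carrier K\<rbrakk> \<Longrightarrow>
      x \<star> (y \<otimes> z) = (x \<star> y) \<otimes> gconj K y (x \<star> z)"
    and mult_star: "\<lbrakk>x \<in> carrier K; y \<in> carrier K; z \<in> carrier K\<rbrakk> \<Longrightarrow>
      (x \<otimes> y) \<star> z = gconj K x (y \<star> z) \<otimes> (x \<star> z)"
    and star_jacobi: "\<lbrakk>x \<in> carrier K; y \<in> carrier K; z \<in> carrier K\<rbrakk> \<Longrightarrow>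
      ((x \<star> y) \<star> gconj K y z) \<otimes> ((y \<star> z) \<star> gconj K z x) \<otimes> ((z \<star> x) \<star> gconj K x y) = \<one>"
    and gconj_star: "\<lbrakk>x \<in> carrier K; y \<in> carrier K; z \<in> carrier K\<rbrakk> \<Longrightarrow>
      gconj K z (x \<star> y) = gconj K z x \<star> gconj K z y"

definition mla_ideal :: "'a set \<Rightarrow> ('a, 'm) mla_scheme \<Rightarrow> bool" where
  "mla_ideal I K \<longleftrightarrow> I \<lhd> K \<and> (\<forall>g\<in>carrier K. \<forall>a\<in>I. g \<star>\<^bsub>K\<^esub> a \<in> I)"

definition mla_genideal :: "('a, 'm) mla_scheme \<Rightarrow> 'a set \<Rightarrow> 'a set" where
  "mla_genideal K S = \<Inter>{I. mla_ideal I K \<and> S \<subseteq> I}"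

text \<open>As for \<^const>\<open>FactGroup\<close>, the operation on cosets is the union over all representatives;
  if \<open>I\<close> is an ideal, this union is a single coset.\<close>

definition mla_quot :: "('a, 'm) mla_scheme \<Rightarrow> 'a set \<Rightarrow> 'a set mla" where
  "mla_quot K I =
    \<lparr>carrier = carrier (K Mod I), monoid.mult = (\<otimes>\<^bsub>K Mod I\<^esub>), one = \<one>\<^bsub>K Mod I\<^esub>,
     lie_star = (\<lambda>A B. \<Union>a\<in>A. \<Union>b\<in>B. I #>\<^bsub>K\<^esub> (a \<star>\<^bsub>K\<^esub> b))\<rparr>"

section \<open>Lie solvability\<close>

definition lie_commutator :: "('a, 'm) mla_scheme \<Rightarrow> 'a \<Rightarrow> 'a \<Rightarrow> 'a" where
  "lie_commutator K a b = inv\<^bsub>K\<^esub> (a \<star>\<^bsub>K\<^esub> b) \<otimes>\<^bsub>K\<^esub> gcomm K a b"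

definition lie_derived :: "('a, 'm) mla_scheme \<Rightarrow> 'a set" where
  "lie_derived K = mla_genideal K {lie_commutator K a b | a b. a \<in> carrier K \<and> b \<in> carrier K}"

primrec lie_derived_series :: "('a, 'm) mla_scheme \<Rightarrow> nat \<Rightarrow> 'a set" where
  "lie_derived_series K 0 = carrier K"
| "lie_derived_series K (Suc k) = lie_derived (K\<lparr>carrier := lie_derived_series K k\<rparr>)"

definition lie_solvable :: "('a, 'm) mla_scheme \<Rightarrow> bool" where
  "lie_solvable K \<longleftrightarrow> (\<exists>n. lie_derived_series K n = {\<one>\<^bsub>K\<^esub>})"

text \<open>Only meaningful for Lie solvable \<open>K\<close>.\<close>

definition lie_length :: "('a, 'm) mla_scheme \<Rightarrow> nat" where
  "lie_length K = (LEAST n. lie_derived_series K n = {\<one>\<^bsub>K\<^esub>})"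

section \<open>Mutual actions\<close>

text \<open>In the following, \<open>aG\<close> and \<open>aH\<close> are the group actions of \<open>G\<close> on \<open>H\<close> and of \<open>H\<close> on \<open>G\<close>,
  while \<open>bG\<close> and \<open>bH\<close> are the brackets \<open>G \<times> H \<rightarrow> H\<close> and \<open>H \<times> G \<rightarrow> G\<close>.
  The first locale collects the conditions on \<open>aG\<close> and \<open>bG\<close>; exchanging the roles of \<open>G\<close> and \<open>H\<close>
  gives those on \<open>aH\<close> and \<open>bH\<close>.\<close>

locale mla_action =
  G: multiplicative_lie_algebra G + H: multiplicative_lie_algebra H
  for G :: "('a, 'm) mla_scheme" and H :: "('b, 'k) mla_scheme"
    and aG :: "'a \<Rightarrow> 'b \<Rightarrow> 'b" and aH :: "'b \<Rightarrow> 'a \<Rightarrow> 'a"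
    and bG :: "'a \<Rightarrow> 'b \<Rightarrow> 'b" and bH :: "'b \<Rightarrow> 'a \<Rightarrow> 'a" +
  assumes act_hom: "aG \<in> hom G (AutoGroup H)"
    and br_closed: "\<lbrakk>x \<in> carrier G; y \<in> carrier H\<rbrakk> \<Longrightarrow> bG x y \<in> carrier H"
    and br_mult_right: "\<lbrakk>x \<in> carrier G; y \<in> carrier H; y' \<in> carrier H\<rbrakk> \<Longrightarrow>
      bG x (y \<otimes>\<^bsub>H\<^esub> y') = bG x y \<otimes>\<^bsub>H\<^esub> bG (aH y x) (gconj H y y')"
    and br_mult_left: "\<lbrakk>x \<in> carrier G; x' \<in> carrier G; y \<in> carrier H\<rbrakk> \<Longrightarrow>
      bG (x \<otimes>\<^bsub>G\<^esub> x') y = bG (gconj G x x') (aG x y) \<otimes>\<^bsub>H\<^esub> bG x y"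
    and br_star_left: "\<lbrakk>x \<in> carrier G; x' \<in> carrier G; y \<in> carrier H\<rbrakk> \<Longrightarrow>
      bG (x \<star>\<^bsub>G\<^esub> x') (aG x' y)
      \<otimes>\<^bsub>H\<^esub> inv\<^bsub>H\<^esub> (bG (aH y x) (bG x' y))
      \<otimes>\<^bsub>H\<^esub> inv\<^bsub>H\<^esub> (bG (gconj G x x') (inv\<^bsub>H\<^esub> (bG x y))) = \<one>\<^bsub>H\<^esub>"
    and br_star_right: "\<lbrakk>x \<in> carrier G; y \<in> carrier H; y' \<in> carrier H\<rbrakk> \<Longrightarrow>
      bG (aH y' x) (y \<star>\<^bsub>H\<^esub> y')
      \<otimes>\<^bsub>H\<^esub> inv\<^bsub>H\<^esub> (bG (inv\<^bsub>G\<^esub> (bH y x)) (gconj H y y'))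
      \<otimes>\<^bsub>H\<^esub> inv\<^bsub>H\<^esub> (bG (bH y' x) (aG x y)) = \<one>\<^bsub>H\<^esub>"

locale compatible_mla_actions =
  GH: mla_action G H aG aH bG bH + HG: mla_action H G aH aG bH bG
  for G :: "('a, 'm) mla_scheme" and H :: "('b, 'k) mla_scheme"
    and aG :: "'a \<Rightarrow> 'b \<Rightarrow> 'b" and aH :: "'b \<Rightarrow> 'a \<Rightarrow> 'a"
    and bG :: "'a \<Rightarrow> 'b \<Rightarrow> 'b" and bH :: "'b \<Rightarrow> 'a \<Rightarrow> 'a" +
  assumes compat_act_G: "\<lbrakk>g \<in> carrier G; g' \<in> carrier G; h \<in> carrier H\<rbrakk> \<Longrightarrow>
      aH (aG g h) g' = gconj G g (aH h (gconj G (inv\<^bsub>G\<^esub> g) g'))"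
    and compat_act_H: "\<lbrakk>g \<in> carrier G; h \<in> carrier H; h' \<in> carrier H\<rbrakk> \<Longrightarrow>
      aG (aH h g) h' = gconj H h (aG g (gconj H (inv\<^bsub>H\<^esub> h) h'))"
    and compat_br_H: "\<lbrakk>g \<in> carrier G; h \<in> carrier H; h' \<in> carrier H\<rbrakk> \<Longrightarrow>
      bG (inv\<^bsub>G\<^esub> (bH h g)) h' = bG g h \<star>\<^bsub>H\<^esub> h'"
    and compat_br_G: "\<lbrakk>g \<in> carrier G; g' \<in> carrier G; h \<in> carrier H\<rbrakk> \<Longrightarrow>
      bH (inv\<^bsub>H\<^esub> (bG g h)) g' = bH h g \<star>\<^bsub>G\<^esub> g'"
    and compat_triv_H: "\<lbrakk>g \<in> carrier G; h \<in> carrier H; h' \<in> carrier H\<rbrakk> \<Longrightarrow>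
      gconj H (bG g h) (aG (bH h g) h') = h'"
    and compat_triv_G: "\<lbrakk>g \<in> carrier G; g' \<in> carrier G; h \<in> carrier H\<rbrakk> \<Longrightarrow>
      aH (bG g h) (gconj G (bH h g) g') = g'"
    and compat_equivar_G: "\<lbrakk>g \<in> carrier G; g' \<in> carrier G; h \<in> carrier H\<rbrakk> \<Longrightarrow>
      gconj G g (bH h g') = bH (aG g h) (gconj G g g')"
    and compat_equivar_H: "\<lbrakk>g \<in> carrier G; h \<in> carrier H; h' \<in> carrier H\<rbrakk> \<Longrightarrow>
      gconj H h (bG g h') = bG (aH h g) (gconj H h h')"
    and compat_disp_H: "\<lbrakk>g \<in> carrier G; h \<in> carrier H; h' \<in> carrier H\<rbrakk> \<Longrightarrow>
      bG (g \<otimes>\<^bsub>G\<^esub> aH h (inv\<^bsub>G\<^esub> g)) h' = (aG g h \<otimes>\<^bsub>H\<^esub> inv\<^bsub>H\<^esub> h) \<star>\<^bsub>H\<^esub> h'"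
    and compat_disp_G: "\<lbrakk>g \<in> carrier G; g' \<in> carrier G; h \<in> carrier H\<rbrakk> \<Longrightarrow>
      bH (h \<otimes>\<^bsub>H\<^esub> aG g (inv\<^bsub>H\<^esub> h)) g' = (aH h g \<otimes>\<^bsub>G\<^esub> inv\<^bsub>G\<^esub> g) \<star>\<^bsub>G\<^esub> g'"

text \<open>The subgroup \<open>\<^sup>L[H,G]\<close> of \<open>G\<close>, and the subgroup \<open>\<langle>G,H\<rangle>\<close> of \<open>H\<close>.\<close>

definition lie_displacement ::
  "('a, 'm) mla_scheme \<Rightarrow> ('b, 'k) mla_scheme \<Rightarrow> ('b \<Rightarrow> 'a \<Rightarrow> 'a) \<Rightarrow> ('b \<Rightarrow> 'a \<Rightarrow> 'a) \<Rightarrow> 'a set"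
where
  "lie_displacement G H aH bH =
    generate G {inv\<^bsub>G\<^esub> (bH h g) \<otimes>\<^bsub>G\<^esub> (aH h g \<otimes>\<^bsub>G\<^esub> inv\<^bsub>G\<^esub> g) | h g.
      h \<in> carrier H \<and> g \<in> carrier G}"

definition bracket_subgroup ::
  "('a, 'm) mla_scheme \<Rightarrow> ('b, 'k) mla_scheme \<Rightarrow> ('a \<Rightarrow> 'b \<Rightarrow> 'b) \<Rightarrow> 'b set"
where
  "bracket_subgroup G H bG = generate H {bG g h | g h. g \<in> carrier G \<and> h \<in> carrier H}"

section \<open>Presentations of multiplicative Lie algebras\<close>

datatype 'g mla_term =
  Gen 'g
| TOne
| TMul "'g mla_term" "'g mla_term"
| TInv "'g mla_term"
| TStar "'g mla_term" "'g mla_term"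

definition mla_terms :: "'g set \<Rightarrow> 'g mla_term set" where
  "mla_terms S = {t. set_mla_term t \<subseteq> S}"

definition TConj :: "'g mla_term \<Rightarrow> 'g mla_term \<Rightarrow> 'g mla_term" where
  "TConj s t = TMul (TMul s t) (TInv s)"

text \<open>The least congruence on the terms over \<open>S\<close> that contains \<open>R\<close> and the axioms of
  multiplicative Lie algebras. All elements of \<open>R\<close> that are not pairs of terms over \<open>S\<close>
  are ignored.\<close>

inductive_set mla_cong :: "'g set \<Rightarrow> ('g mla_term \<times> 'g mla_term) set \<Rightarrow> ('g mla_term \<times> 'g mla_term) set"
  for S :: "'g set" and R :: "('g mla_term \<times> 'g mla_term) set"
where
  rel: "\<lbrakk>(s, t) \<in> R; s \<in> mla_terms S; t \<in> mla_terms S\<rbrakk> \<Longrightarrow> (s, t) \<in> mla_cong S R"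
| refl: "s \<in> mla_terms S \<Longrightarrow> (s, s) \<in> mla_cong S R"
| sym: "(s, t) \<in> mla_cong S R \<Longrightarrow> (t, s) \<in> mla_cong S R"
| trans: "\<lbrakk>(s, t) \<in> mla_cong S R; (t, u) \<in> mla_cong S R\<rbrakk> \<Longrightarrow> (s, u) \<in> mla_cong S R"
| cong_mul: "\<lbrakk>(s, s') \<in> mla_cong S R; (t, t') \<in> mla_cong S R\<rbrakk> \<Longrightarrow>
    (TMul s t, TMul s' t') \<in> mla_cong S R"
| cong_inv: "(s, s') \<in> mla_cong S R \<Longrightarrow> (TInv s, TInv s') \<in> mla_cong S R"
| cong_star: "\<lbrakk>(s, s') \<in> mla_cong S R; (t, t') \<in> mla_cong S R\<rbrakk> \<Longrightarrow>
    (TStar s t, TStar s' t') \<in> mla_cong S R"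
| mul_assoc: "\<lbrakk>s \<in> mla_terms S; t \<in> mla_terms S; u \<in> mla_terms S\<rbrakk> \<Longrightarrow>
    (TMul (TMul s t) u, TMul s (TMul t u)) \<in> mla_cong S R"
| mul_one: "s \<in> mla_terms S \<Longrightarrow> (TMul TOne s, s) \<in> mla_cong S R"
| mul_inv: "s \<in> mla_terms S \<Longrightarrow> (TMul (TInv s) s, TOne) \<in> mla_cong S R"
| star_self: "s \<in> mla_terms S \<Longrightarrow> (TStar s s, TOne) \<in> mla_cong S R"
| star_mul: "\<lbrakk>s \<in> mla_terms S; t \<in> mla_terms S; u \<in> mla_terms S\<rbrakk> \<Longrightarrow>
    (TStar s (TMul t u), TMul (TStar s t) (TConj t (TStar s u))) \<in> mla_cong S R"
| mul_star: "\<lbrakk>s \<in> mla_terms S; t \<in> mla_terms S; u \<in> mla_terms S\<rbrakk> \<Longrightarrow>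
    (TStar (TMul s t) u, TMul (TConj s (TStar t u)) (TStar s u)) \<in> mla_cong S R"
| jacobi: "\<lbrakk>s \<in> mla_terms S; t \<in> mla_terms S; u \<in> mla_terms S\<rbrakk> \<Longrightarrow>
    (TMul (TMul (TStar (TStar s t) (TConj t u)) (TStar (TStar t u) (TConj u s)))
       (TStar (TStar u s) (TConj s t)), TOne) \<in> mla_cong S R"
| conj_star: "\<lbrakk>s \<in> mla_terms S; t \<in> mla_terms S; u \<in> mla_terms S\<rbrakk> \<Longrightarrow>
    (TConj u (TStar s t), TStar (TConj u s) (TConj u t)) \<in> mla_cong S R"

definition mla_presented :: "'g set \<Rightarrow> ('g mla_term \<times> 'g mla_term) set \<Rightarrow> 'g mla_term set mla" where
  "mla_presented S R =
    \<lparr>carrier = mla_terms S // mla_cong S R,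
     monoid.mult = (\<lambda>A B. \<Union>s\<in>A. \<Union>t\<in>B. mla_cong S R `` {TMul s t}),
     one = mla_cong S R `` {TOne},
     lie_star = (\<lambda>A B. \<Union>s\<in>A. \<Union>t\<in>B. mla_cong S R `` {TStar s t})\<rparr>"

section \<open>The tensor product\<close>

inductive_set tensor_rels ::
  "('a, 'm) mla_scheme \<Rightarrow> ('b, 'k) mla_scheme \<Rightarrow> ('a \<Rightarrow> 'b \<Rightarrow> 'b) \<Rightarrow> ('b \<Rightarrow> 'a \<Rightarrow> 'a) \<Rightarrow>
   ('a \<Rightarrow> 'b \<Rightarrow> 'b) \<Rightarrow> ('b \<Rightarrow> 'a \<Rightarrow> 'a) \<Rightarrow> (('a \<times> 'b) mla_term \<times> ('a \<times> 'b) mla_term) set"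
  for G :: "('a, 'm) mla_scheme" and H :: "('b, 'k) mla_scheme"
    and aG :: "'a \<Rightarrow> 'b \<Rightarrow> 'b" and aH :: "'b \<Rightarrow> 'a \<Rightarrow> 'a"
    and bG :: "'a \<Rightarrow> 'b \<Rightarrow> 'b" and bH :: "'b \<Rightarrow> 'a \<Rightarrow> 'a"
where
  mult_right: "\<lbrakk>x \<in> carrier G; y \<in> carrier H; y' \<in> carrier H\<rbrakk> \<Longrightarrow>
    (Gen (x, y \<otimes>\<^bsub>H\<^esub> y'), TMul (Gen (x, y)) (Gen (aH y x, gconj H y y')))
      \<in> tensor_rels G H aG aH bG bH"
| mult_left: "\<lbrakk>x \<in> carrier G; x' \<in> carrier G; y \<in> carrier H\<rbrakk> \<Longrightarrow>
    (Gen (x \<otimes>\<^bsub>G\<^esub> x', y), TMul (Gen (gconj G x x', aG x y)) (Gen (x, y)))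
      \<in> tensor_rels G H aG aH bG bH"
| star_left: "\<lbrakk>x \<in> carrier G; x' \<in> carrier G; y \<in> carrier H\<rbrakk> \<Longrightarrow>
    (TMul (TMul (Gen (x \<star>\<^bsub>G\<^esub> x', aG x' y))
       (TInv (Gen (aH y x, bG x' y))))
       (TInv (Gen (gconj G x x', inv\<^bsub>H\<^esub> (bG x y)))), TOne)
      \<in> tensor_rels G H aG aH bG bH"
| star_right: "\<lbrakk>x \<in> carrier G; y \<in> carrier H; y' \<in> carrier H\<rbrakk> \<Longrightarrow>
    (TMul (TMul (Gen (aH y' x, y \<star>\<^bsub>H\<^esub> y'))
       (TInv (Gen (inv\<^bsub>G\<^esub> (bH y x), gconj H y y'))))
       (TInv (Gen (bH y' x, aG x y))), TOne)
      \<in> tensor_rels G H aG aH bG bH"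
| star_gens: "\<lbrakk>x \<in> carrier G; x' \<in> carrier G; y \<in> carrier H; y' \<in> carrier H\<rbrakk> \<Longrightarrow>
    (TStar (Gen (x, y)) (Gen (x', y')), Gen (inv\<^bsub>G\<^esub> (bH y x), bG x' y'))
      \<in> tensor_rels G H aG aH bG bH"

definition mla_tensor ::
  "('a, 'm) mla_scheme \<Rightarrow> ('b, 'k) mla_scheme \<Rightarrow> ('a \<Rightarrow> 'b \<Rightarrow> 'b) \<Rightarrow> ('b \<Rightarrow> 'a \<Rightarrow> 'a) \<Rightarrow>
   ('a \<Rightarrow> 'b \<Rightarrow> 'b) \<Rightarrow> ('b \<Rightarrow> 'a \<Rightarrow> 'a) \<Rightarrow> ('a \<times> 'b) mla_term set mla"
where
  "mla_tensor G H aG aH bG bH =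
    mla_presented (carrier G \<times> carrier H) (tensor_rels G H aG aH bG bH)"

definition tensor_elem ::
  "('a, 'm) mla_scheme \<Rightarrow> ('b, 'k) mla_scheme \<Rightarrow> ('a \<Rightarrow> 'b \<Rightarrow> 'b) \<Rightarrow> ('b \<Rightarrow> 'a \<Rightarrow> 'a) \<Rightarrow>
   ('a \<Rightarrow> 'b \<Rightarrow> 'b) \<Rightarrow> ('b \<Rightarrow> 'a \<Rightarrow> 'a) \<Rightarrow> 'a \<Rightarrow> 'b \<Rightarrow> ('a \<times> 'b) mla_term set"
where
  "tensor_elem G H aG aH bG bH x y =
    mla_cong (carrier G \<times> carrier H) (tensor_rels G H aG aH bG bH) `` {Gen (x, y)}"

definition ideal_tensor ::
  "('a, 'm) mla_scheme \<Rightarrow> ('b, 'k) mla_scheme \<Rightarrow> ('a \<Rightarrow> 'b \<Rightarrow> 'b) \<Rightarrow> ('b \<Rightarrow> 'a \<Rightarrow> 'a) \<Rightarrow>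
   ('a \<Rightarrow> 'b \<Rightarrow> 'b) \<Rightarrow> ('b \<Rightarrow> 'a \<Rightarrow> 'a) \<Rightarrow> 'a set \<Rightarrow> 'b set \<Rightarrow> ('a \<times> 'b) mla_term set set"
where
  "ideal_tensor G H aG aH bG bH I J =
    generate (mla_tensor G H aG aH bG bH)
      {tensor_elem G H aG aH bG bH a b | a b. a \<in> I \<and> b \<in> J}"

end

theory Submission
  imports Defs
begin

text \<open>Write \<open>\<phi> = \<langle>x,y\<rangle>\<close>, \<open>\<psi> = \<langle>y,x\<rangle>\<inverse>\<close> and \<open>c = \<^sup>xy y\<inverse>\<close> for a generator \<open>x \<otimes> y\<close>. The subalgebras of
  \<open>(G \<otimes> H) \<times> H\<close> generated by the pairs \<open>(x \<otimes> y, \<phi>)\<close> and by the pairs \<open>(x \<otimes> y, c)\<close> are already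
  generated by these pairs as groups, so each element \<open>t\<close> of the \<open>k\<close>-th term of the Lie derived series of
  \<open>G \<otimes> H\<close> has partners \<open>d\<close>, \<open>e\<close> in the \<open>k\<close>-th term for \<open>H\<close>. (The second relation need not be
  a map: \<open>x \<otimes> y \<mapsto> c\<close> does not respect the relations that involve the star operation.) As in the theory of Brown
  and Loday, \<open>t\<close> acts by conjugation on \<open>G \<otimes> H\<close> through \<open>e\<close>, and \<open>(x \<otimes> y) \<star> t = \<psi> \<otimes> d\<close>. If
  \<open>H\<close> has length \<open>n\<close>, this makes the \<open>n\<close>-th term of \<open>G \<otimes> H\<close> central and star-trivial, so the
  \<open>(n+1)\<close>-st term vanishes even before passing to the quotient.\<close>

section \<open>Multiplicative Lie algebras\<close>

context group
begin

lemma inv_mult_cancel_left: "\<lbrakk>x \<in> carrier G; y \<in> carrier G\<rbrakk> \<Longrightarrow> inv x \<otimes> (x \<otimes> y) = y"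
  by (simp add: inv_solve_left')

lemma mult_inv_cancel_left: "\<lbrakk>x \<in> carrier G; y \<in> carrier G\<rbrakk> \<Longrightarrow> x \<otimes> (inv x \<otimes> y) = y"
  by (metis inv_mult_cancel_left inv_closed inv_inv)

lemmas group_simps = m_assoc inv_mult_group inv_mult_cancel_left mult_inv_cancel_left

lemma gconj_closed [simp]: "\<lbrakk>z \<in> carrier G; x \<in> carrier G\<rbrakk> \<Longrightarrow> gconj G z x \<in> carrier G"
  by (simp add: gconj_def)

lemma gconj_one_right [simp]: "z \<in> carrier G \<Longrightarrow> gconj G z \<one> = \<one>"
  by (simp add: gconj_def)

lemma gconj_one_left [simp]: "x \<in> carrier G \<Longrightarrow> gconj G \<one> x = x"
  by (simp add: gconj_def)

lemma gconj_mult: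
  "\<lbrakk>z \<in> carrier G; x \<in> carrier G; y \<in> carrier G\<rbrakk> \<Longrightarrow>
    gconj G z (x \<otimes> y) = gconj G z x \<otimes> gconj G z y"
  by (simp add: gconj_def group_simps)

lemma gconj_inv:
  "\<lbrakk>z \<in> carrier G; x \<in> carrier G\<rbrakk> \<Longrightarrow> gconj G z (inv x) = inv (gconj G z x)"
  by (simp add: gconj_def group_simps)

lemma gconj_comp:
  "\<lbrakk>z \<in> carrier G; w \<in> carrier G; x \<in> carrier G\<rbrakk> \<Longrightarrow> gconj G (z \<otimes> w) x = gconj G z (gconj G w x)"
  by (simp add: gconj_def group_simps)

lemma gconj_inv_cancel [simp]:
  "\<lbrakk>z \<in> carrier G; x \<in> carrier G\<rbrakk> \<Longrightarrow> gconj G (inv z) (gconj G z x) = x"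
  "\<lbrakk>z \<in> carrier G; x \<in> carrier G\<rbrakk> \<Longrightarrow> gconj G z (gconj G (inv z) x) = x"
  by (simp_all flip: gconj_comp)

lemma gconj_self [simp]: "x \<in> carrier G \<Longrightarrow> gconj G x x = x"
  by (simp add: gconj_def m_assoc)

lemma gcomm_eq:
  "\<lbrakk>a \<in> carrier G; b \<in> carrier G\<rbrakk> \<Longrightarrow> gcomm G a b = gconj G a b \<otimes> inv b"
  by (simp add: gcomm_def gconj_def)

lemma gcomm_eq':
  "\<lbrakk>a \<in> carrier G; b \<in> carrier G\<rbrakk> \<Longrightarrow> gcomm G a b = a \<otimes> inv (gconj G b a)"
  by (simp add: gcomm_def gconj_def group_simps)

lemma normal_gconj_closed: "\<lbrakk>M \<lhd> G; z \<in> carrier G; x \<in> M\<rbrakk> \<Longrightarrow> gconj G z x \<in> M"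
  by (auto simp: normal_inv_iff gconj_def)

end

section \<open>First consequences of the axioms for the star operation\<close>

context multiplicative_lie_algebra
begin

declare star_closed [simp]

lemma star_one [simp]: "x \<in> carrier K \<Longrightarrow> x \<star> \<one> = \<one>"
  using star_mult[of x \<one> \<one>] by simp

lemma one_star [simp]: "x \<in> carrier K \<Longrightarrow> \<one> \<star> x = \<one>"
  using mult_star[of \<one> \<one> x] by simp

lemma star_inv:
  assumes "x \<in> carrier K" "y \<in> carrier K"
  shows "x \<star> inv y = gconj K (inv y) (inv (x \<star> y))"
proof -
  have "(x \<star> inv y) \<otimes> gconj K (inv y) (x \<star> y) = \<one>"
    using assms star_mult[of x "inv y" y] by simp
  then show ?thesis
    using assms by (simp add: gconj_inv inv_equality[symmetric] inv_inv)
qed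

lemma inv_star:
  assumes "x \<in> carrier K" "y \<in> carrier K"
  shows "inv x \<star> y = gconj K (inv x) (inv (x \<star> y))"
proof -
  have "gconj K (inv x) (x \<star> y) \<otimes> (inv x \<star> y) = \<one>"
    using assms mult_star[of "inv x" x y] by simp
  then show ?thesis
    using assms by (metis gconj_inv inv_closed inv_equality inv_inv star_closed gconj_closed)
qed

text \<open>Polarization: expanding \<open>(x \<otimes> y) \<star> (x \<otimes> y) = \<one>\<close>
  in both arguments kills the self-stars and leaves an \<open>x\<close>-conjugate of the product of
  the two mixed stars.\<close>

lemma star_antisym:
  assumes "x \<in> carrier K" "y \<in> carrier K"
  shows "y \<star> x = inv (x \<star> y)"
proof -
  have "gconj K x ((y \<star> x) \<otimes> (x \<star> y)) = \<one>"
  proof -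
    have "(x \<otimes> y) \<star> (x \<otimes> y) = gconj K x ((y \<star> x) \<otimes> (x \<star> y))"
      using assms
      by (simp add: mult_star[of x y "x \<otimes> y"] star_mult[of x x y] star_mult[of y x y] star_self[of x] star_self[of y]
          gconj_mult)
    then show ?thesis using assms by (simp add: star_self)
  qed
  then have "(y \<star> x) \<otimes> (x \<star> y) = \<one>"
    using assms by (metis gconj_inv_cancel(1) gconj_one_right inv_closed m_closed star_closed)
  then show ?thesis
    using assms by (simp add: inv_equality)
qed

text \<open>The product rules expand the star of two words into conjugates of stars of letters and
  their inverses, and the conjugating elements come from the two generated subgroups. Hence it is
  enough that these subgroups normalize \<open>M\<close>. The induction runs over \<open>b\<close>
  first, with a single letter on the left, and then over \<open>a\<close>.\<close>

lemma star_generate: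
  assumes A: "A \<subseteq> carrier K" and B: "B \<subseteq> carrier K" and M: "subgroup M K"
    and conjA: "\<And>a m. \<lbrakk>a \<in> generate K A; m \<in> M\<rbrakk> \<Longrightarrow> gconj K a m \<in> M"
    and conjB: "\<And>a m. \<lbrakk>a \<in> generate K B; m \<in> M\<rbrakk> \<Longrightarrow> gconj K a m \<in> M"
    and AB: "\<And>x y. \<lbrakk>x \<in> A; y \<in> B\<rbrakk> \<Longrightarrow> x \<star> y \<in> M"
    and a: "a \<in> generate K A" and b: "b \<in> generate K B"
  shows "a \<star> b \<in> M"
proof -
  note cA = generate_in_carrier[OF A] and cB = generate_in_carrier[OF B]
  note M' = subgroup.m_inv_closed[OF M] subgroup.m_closed[OF M] subgroup.one_closed[OF M]
  have gens: "x \<star> b \<in> M" if x: "x \<in> A" for x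
    using b
  proof induction
    case one
    then show ?case using x A M' by auto
  next
    case (incl h)
    then show ?case using x AB by blast
  next
    case (inv h)
    then have "gconj K (inv h) (inv (x \<star> h)) \<in> M"
      using x AB conjB M' generate.inv by metis
    then show ?case using inv x subsetD[OF A] subsetD[OF B] by (simp add: star_inv)
  next
    case (eng h1 h2)
    then have "(x \<star> h1) \<otimes> gconj K h1 (x \<star> h2) \<in> M" using conjB M' by blast
    then show ?case using eng x A cB by (auto simp: star_mult)
  qed
  show ?thesis
    using a
  proof induction
    case one
    then show ?case using b cB M' by auto
  next
    case (incl h)
    then show ?case by (rule gens)
  next
    case (inv h)
    then have "gconj K (inv h) (inv (h \<star> b)) \<in> M"
      using gens conjA M' generate.inv by metis
    then show ?case using inv b A cB by (auto simp: inv_star)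
  next
    case (eng h1 h2)
    then have "gconj K h1 (h2 \<star> b) \<otimes> (h1 \<star> b) \<in> M" using conjA M' by blast
    then show ?case using eng b cA cB by (auto simp: mult_star)
  qed
qed

end

text \<open>Apart from closure the star axioms are identities, and a surjection compatible with
  product and star carries identities over to its image. This serves for the coset algebra.\<close>

lemma multiplicative_lie_algebra_homI:
  fixes K :: "('a, 'm) mla_scheme" and Q :: "('c, 'q) mla_scheme"
  assumes "multiplicative_lie_algebra K" and "group Q" and q: "q \<in> hom K Q"
    and surj: "q ` carrier K = carrier Q"
    and star: "\<And>x y. \<lbrakk>x \<in> carrier K; y \<in> carrier K\<rbrakk> \<Longrightarrow> q x \<star>\<^bsub>Q\<^esub> q y = q (x \<star>\<^bsub>K\<^esub> y)"
  shows "multiplicative_lie_algebra Q"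
proof -
  interpret K: multiplicative_lie_algebra K by fact
  interpret Q: group Q by fact
  interpret q: group_hom K Q q
    using q by (unfold_locales)
  have gconj: "gconj Q (q x) (q y) = q (gconj K x y)" if "x \<in> carrier K" "y \<in> carrier K" for x y
    using that by (simp add: gconj_def)
  have reprs: "\<exists>x\<in>carrier K. u = q x" if "u \<in> carrier Q" for u
    using that surj by auto
  note mult = q.hom_mult[symmetric] and one = q.hom_one[symmetric]
  show ?thesis
  proof
    fix u v assume "u \<in> carrier Q" "v \<in> carrier Q"
    then obtain x y where xy: "u = q x" "v = q y" "x \<in> carrier K" "y \<in> carrier K"
      using reprs by metis
    then show "u \<star>\<^bsub>Q\<^esub> v \<in> carrier Q" by (simp add: star)
  next
    fix u assume "u \<in> carrier Q"
    then obtain x where "u = q x" "x \<in> carrier K" using reprs by metis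
    then show "u \<star>\<^bsub>Q\<^esub> u = \<one>\<^bsub>Q\<^esub>" by (simp add: star K.star_self)
  next
    fix u v w assume "u \<in> carrier Q" "v \<in> carrier Q" "w \<in> carrier Q"
    then obtain x y z where xyz: "u = q x" "v = q y" "w = q z"
        "x \<in> carrier K" "y \<in> carrier K" "z \<in> carrier K"
      using reprs by metis
    show "u \<star>\<^bsub>Q\<^esub> (v \<otimes>\<^bsub>Q\<^esub> w) = (u \<star>\<^bsub>Q\<^esub> v) \<otimes>\<^bsub>Q\<^esub> gconj Q v (u \<star>\<^bsub>Q\<^esub> w)"
      using xyz by (simp add: star gconj K.star_mult del: q.hom_mult add: mult)
    show "(u \<otimes>\<^bsub>Q\<^esub> v) \<star>\<^bsub>Q\<^esub> w = gconj Q u (v \<star>\<^bsub>Q\<^esub> w) \<otimes>\<^bsub>Q\<^esub> (u \<star>\<^bsub>Q\<^esub> w)"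
      using xyz by (simp add: star gconj K.mult_star del: q.hom_mult add: mult)
    show "((u \<star>\<^bsub>Q\<^esub> v) \<star>\<^bsub>Q\<^esub> gconj Q v w) \<otimes>\<^bsub>Q\<^esub> ((v \<star>\<^bsub>Q\<^esub> w) \<star>\<^bsub>Q\<^esub> gconj Q w u)
      \<otimes>\<^bsub>Q\<^esub> ((w \<star>\<^bsub>Q\<^esub> u) \<star>\<^bsub>Q\<^esub> gconj Q u v) = \<one>\<^bsub>Q\<^esub>"
      using xyz by (simp add: star gconj K.star_jacobi del: q.hom_mult add: mult)
    show "gconj Q w (u \<star>\<^bsub>Q\<^esub> v) = gconj Q w u \<star>\<^bsub>Q\<^esub> gconj Q w v"
      using xyz by (simp add: star gconj K.gconj_star)
  qed
qed

section \<open>Quotients\<close>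

locale mla_ideal_quotient = multiplicative_lie_algebra K
  for K :: "('a, 'm) mla_scheme" (structure) and I :: "'a set" +
  assumes ideal: "mla_ideal I K"
begin

lemma normal: "I \<lhd> K"
  using ideal by (simp add: mla_ideal_def)

lemma star_ideal_right: "\<lbrakk>g \<in> carrier K; i \<in> I\<rbrakk> \<Longrightarrow> g \<star> i \<in> I"
  using ideal by (simp add: mla_ideal_def)

lemma subgroup: "subgroup I K"
  by (rule normal_imp_subgroup[OF normal])

lemma in_carrier: "i \<in> I \<Longrightarrow> i \<in> carrier K"
  by (rule subgroup.mem_carrier[OF subgroup])

lemma star_ideal_left: "\<lbrakk>g \<in> carrier K; i \<in> I\<rbrakk> \<Longrightarrow> i \<star> g \<in> I"
  by (metis star_antisym star_ideal_right subgroup subgroup.m_inv_closed in_carrier)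

lemma coset_eqI: "\<lbrakk>i \<in> I; x \<in> carrier K\<rbrakk> \<Longrightarrow> I #> (i \<otimes> x) = I #> x"
  by (metis in_carrier repr_independence rcosI subgroup subgroup.subset)

text \<open>With \<open>w = x \<star> y\<close>, the product rule gives \<open>gconj K i w\<close>
  times \<open>i \<star> y\<close>. Moving \<open>w\<close> to the right end leaves in front of it a
  product of elements of \<open>I\<close>, by normality and by closure of \<open>I\<close> under
  star.\<close>

lemma coset_star_left:
  assumes "i \<in> I" "x \<in> carrier K" "y \<in> carrier K"
  shows "I #> ((i \<otimes> x) \<star> y) = I #> (x \<star> y)"
proof -
  let ?w = "x \<star> y"
  have "(i \<otimes> x) \<star> y = (i \<otimes> gconj K ?w (inv i) \<otimes> gconj K ?w (i \<star> y)) \<otimes> ?w"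
    using assms in_carrier by (simp add: mult_star gconj_def group_simps)
  moreover have "i \<otimes> gconj K ?w (inv i) \<otimes> gconj K ?w (i \<star> y) \<in> I"
    using assms by (intro subgroup.m_closed[OF subgroup] normal_gconj_closed[OF normal]
        subgroup.m_inv_closed[OF subgroup] star_ideal_left) auto
  ultimately show ?thesis using assms coset_eqI by simp
qed

lemma coset_star_right:
  assumes "i \<in> I" "x \<in> carrier K" "y \<in> carrier K"
  shows "I #> (x \<star> (i \<otimes> y)) = I #> (x \<star> y)"
proof -
  let ?w = "x \<star> y"
  have "x \<star> (i \<otimes> y) = ((x \<star> i) \<otimes> i \<otimes> gconj K ?w (inv i)) \<otimes> ?w"
    using assms in_carrier by (simp add: star_mult gconj_def group_simps)
  moreover have "(x \<star> i) \<otimes> i \<otimes> gconj K ?w (inv i) \<in> I"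
    using assms by (intro subgroup.m_closed[OF subgroup] normal_gconj_closed[OF normal]
        subgroup.m_inv_closed[OF subgroup] star_ideal_right) auto
  ultimately show ?thesis using assms coset_eqI by simp
qed

lemma quot_star:
  assumes "x \<in> carrier K" "y \<in> carrier K"
  shows "(I #> x) \<star>\<^bsub>mla_quot K I\<^esub> (I #> y) = I #> (x \<star> y)"
proof -
  have "I #> (a \<star> b) = I #> (x \<star> y)" if ab: "a \<in> I #> x" "b \<in> I #> y" for a b
  proof -
    from ab obtain i j where "i \<in> I" "j \<in> I" "a = i \<otimes> x" "b = j \<otimes> y"
      by (auto simp: r_coset_def)
    then show ?thesis using assms coset_star_left coset_star_right in_carrier by simp
  qed
  moreover have "x \<in> I #> x" "y \<in> I #> y"
    using assms rcos_self subgroup by auto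
  ultimately have "(\<Union>a\<in>I #> x. \<Union>b\<in>I #> y. I #> (a \<star> b)) = I #> (x \<star> y)"
    by blast
  then show ?thesis
    by (simp add: mla_quot_def)
qed

lemma quot_group: "group (mla_quot K I)"
proof -
  interpret F: group "K Mod I" by (rule normal.factorgroup_is_group[OF normal])
  show ?thesis
    by (rule groupI)
      (use F.l_inv_ex F.m_assoc in \<open>auto simp: mla_quot_def F.m_closed simp del: mult_FactGroup one_FactGroup\<close>)
qed

lemma quot_hom: "(\<lambda>x. I #> x) \<in> hom K (mla_quot K I)"
  using normal.r_coset_hom_Mod[OF normal] by (simp add: hom_def mla_quot_def)

lemma quot_carrier: "carrier (mla_quot K I) = (\<lambda>x. I #> x) ` carrier K"
  by (simp add: mla_quot_def carrier_FactGroup)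

lemma mla_quot: "multiplicative_lie_algebra (mla_quot K I)"
  by (rule multiplicative_lie_algebra_homI[OF multiplicative_lie_algebra_axioms quot_group quot_hom])
    (simp_all add: quot_carrier quot_star)

end

section \<open>Lie derived series and correspondences\<close>

context multiplicative_lie_algebra
begin

text \<open>A term of the derived series arises as an ideal of its predecessor, not of
  \<open>K\<close>; being a subalgebra of \<open>K\<close> is the property that survives the
  iteration.\<close>

definition sub_mla :: "'a set \<Rightarrow> bool" where
  "sub_mla S \<longleftrightarrow> subgroup S K \<and> (\<forall>x\<in>S. \<forall>y\<in>S. x \<star> y \<in> S)"

lemma gconj_restrict:
  "\<lbrakk>subgroup S K; z \<in> S\<rbrakk> \<Longrightarrow> gconj (K\<lparr>carrier := S\<rparr>) z x = gconj K z x"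
  by (simp add: gconj_def m_inv_consistent)

lemma lie_commutator_restrict:
  "\<lbrakk>sub_mla S; x \<in> S; y \<in> S\<rbrakk> \<Longrightarrow> lie_commutator (K\<lparr>carrier := S\<rparr>) x y = lie_commutator K x y"
  by (simp add: lie_commutator_def gcomm_def m_inv_consistent sub_mla_def)

lemma sub_mla_imp_mla:
  assumes "sub_mla S"
  shows "multiplicative_lie_algebra (K\<lparr>carrier := S\<rparr>)"
proof -
  have S: "subgroup S K" and star: "\<And>x y. \<lbrakk>x \<in> S; y \<in> S\<rbrakk> \<Longrightarrow> x \<star> y \<in> S"
    using assms by (auto simp: sub_mla_def)
  note mem = subgroup.mem_carrier[OF S]
  interpret S: group "K\<lparr>carrier := S\<rparr>"
    by (rule subgroup.subgroup_is_group[OF S is_group])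
  show ?thesis
    by unfold_locales
      (simp_all add: star gconj_restrict[OF S] mem star_self star_mult mult_star star_jacobi gconj_star)
qed

lemma mla_ideal_carrier: "mla_ideal (carrier K) K"
  by (auto simp: mla_ideal_def normal_inv_iff subgroup_self)

lemma mla_ideal_genideal:
  assumes "S \<subseteq> carrier K"
  shows "mla_ideal (mla_genideal K S) K"
proof -
  let ?F = "{I. mla_ideal I K \<and> S \<subseteq> I}"
  have "?F \<noteq> {}" using assms mla_ideal_carrier by blast
  then have "subgroup (\<Inter>?F) K"
    by (intro subgroups_Inter) (auto simp: mla_ideal_def normal_imp_subgroup)
  then show ?thesis
    unfolding mla_ideal_def mla_genideal_def normal_inv_iff by blast
qed

lemma lie_commutator_closed [simp]:
  "\<lbrakk>x \<in> carrier K; y \<in> carrier K\<rbrakk> \<Longrightarrow> lie_commutator K x y \<in> carrier K"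
  by (simp add: lie_commutator_def gcomm_def)

lemma mla_ideal_lie_derived: "mla_ideal (lie_derived K) K"
  unfolding lie_derived_def by (rule mla_ideal_genideal) auto

lemma lie_commutator_in_derived:
  "\<lbrakk>x \<in> carrier K; y \<in> carrier K\<rbrakk> \<Longrightarrow> lie_commutator K x y \<in> lie_derived K"
  unfolding lie_derived_def mla_genideal_def by blast

lemma sub_mla_derived:
  assumes "sub_mla S"
  shows "sub_mla (lie_derived (K\<lparr>carrier := S\<rparr>))"
proof -
  have S: "subgroup S K" using assms by (simp add: sub_mla_def)
  interpret S: multiplicative_lie_algebra "K\<lparr>carrier := S\<rparr>" by (rule sub_mla_imp_mla[OF assms])
  have I: "mla_ideal (lie_derived (K\<lparr>carrier := S\<rparr>)) (K\<lparr>carrier := S\<rparr>)"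
    by (rule S.mla_ideal_lie_derived)
  then have sub: "subgroup (lie_derived (K\<lparr>carrier := S\<rparr>)) (K\<lparr>carrier := S\<rparr>)"
    by (simp add: mla_ideal_def normal_imp_subgroup)
  show ?thesis
    using I incl_subgroup[OF S sub] subgroup.subset[OF sub]
    by (auto simp: sub_mla_def mla_ideal_def)
qed

lemma sub_mla_lie_derived_series: "sub_mla (lie_derived_series K k)"
  by (induction k) (simp_all add: sub_mla_derived sub_mla_def[of "carrier K"] subgroup_self)

end

text \<open>A relation that is total on \<open>K\<close> and closed under the operations transports the Lie derived
  series exactly as a homomorphism would, without having to be single-valued.\<close>

locale mla_correspondence =
  K: multiplicative_lie_algebra K + L: multiplicative_lie_algebra L
  for K :: "('a, 'm) mla_scheme" and L :: "('b, 'k) mla_scheme" and P :: "('a \<times> 'b) set" +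
  assumes corr_sub: "(s, d) \<in> P \<Longrightarrow> s \<in> carrier K \<and> d \<in> carrier L"
    and corr_one: "(\<one>\<^bsub>K\<^esub>, \<one>\<^bsub>L\<^esub>) \<in> P"
    and corr_mult: "\<lbrakk>(s, d) \<in> P; (t, e) \<in> P\<rbrakk> \<Longrightarrow> (s \<otimes>\<^bsub>K\<^esub> t, d \<otimes>\<^bsub>L\<^esub> e) \<in> P"
    and corr_inv: "(s, d) \<in> P \<Longrightarrow> (inv\<^bsub>K\<^esub> s, inv\<^bsub>L\<^esub> d) \<in> P"
    and corr_star: "\<lbrakk>(s, d) \<in> P; (t, e) \<in> P\<rbrakk> \<Longrightarrow> (s \<star>\<^bsub>K\<^esub> t, d \<star>\<^bsub>L\<^esub> e) \<in> P"
    and corr_total: "t \<in> carrier K \<Longrightarrow> \<exists>d. (t, d) \<in> P"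
begin

lemma corr_lie_commutator:
  "\<lbrakk>(s, d) \<in> P; (t, e) \<in> P\<rbrakk> \<Longrightarrow> (lie_commutator K s t, lie_commutator L d e) \<in> P"
  by (simp add: lie_commutator_def gcomm_def corr_mult corr_inv corr_star)

lemma corr_gconj: "\<lbrakk>(s, d) \<in> P; (t, e) \<in> P\<rbrakk> \<Longrightarrow> (gconj K s t, gconj L d e) \<in> P"
  by (simp add: gconj_def corr_mult corr_inv)

text \<open>The elements of \<open>S\<close> with a partner in the derived ideal of \<open>D\<close>
  form an ideal of \<open>S\<close>: an arbitrary \<open>g\<close> in \<open>S\<close> has a partner
  in \<open>D\<close> by \<open>tot\<close>, and the partner side is an ideal there. This ideal
  contains all Lie commutators, so it contains the least such ideal.\<close>

lemma corr_derived:
  assumes S: "K.sub_mla S" and D: "L.sub_mla D"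
    and tot: "\<And>t. t \<in> S \<Longrightarrow> \<exists>d\<in>D. (t, d) \<in> P"
    and t: "t \<in> lie_derived (K\<lparr>carrier := S\<rparr>)"
  shows "\<exists>d\<in>lie_derived (L\<lparr>carrier := D\<rparr>). (t, d) \<in> P"
proof -
  let ?K = "K\<lparr>carrier := S\<rparr>" and ?L = "L\<lparr>carrier := D\<rparr>"
  let ?D' = "lie_derived ?L"
  let ?I = "{t \<in> S. \<exists>d\<in>?D'. (t, d) \<in> P}"
  have S': "subgroup S K" and D': "subgroup D L"
    using S D by (auto simp: K.sub_mla_def L.sub_mla_def)
  interpret S: multiplicative_lie_algebra ?K by (rule K.sub_mla_imp_mla[OF S])
  interpret D: multiplicative_lie_algebra ?L by (rule L.sub_mla_imp_mla[OF D])
  have id: "mla_ideal ?D' ?L" by (rule D.mla_ideal_lie_derived)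
  have nor: "?D' \<lhd> ?L" using id by (simp add: mla_ideal_def)
  have subL: "subgroup ?D' L"
    using L.sub_mla_derived[OF D] by (simp add: L.sub_mla_def)
  have "subgroup ?I ?K"
  proof (rule S.subgroupI)
    show "?I \<subseteq> carrier ?K" by auto
    show "?I \<noteq> {}"
      using subgroup.one_closed[OF S'] subgroup.one_closed[OF subL] corr_one by blast
  next
    fix a assume "a \<in> ?I"
    then obtain d where d: "a \<in> S" "d \<in> ?D'" "(a, d) \<in> P" by blast
    then have "(inv\<^bsub>K\<^esub> a, inv\<^bsub>L\<^esub> d) \<in> P" "inv\<^bsub>L\<^esub> d \<in> ?D'" "inv\<^bsub>K\<^esub> a \<in> S"
      using corr_inv subgroup.m_inv_closed[OF subL] subgroup.m_inv_closed[OF S'] by auto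
    then show "inv\<^bsub>?K\<^esub> a \<in> ?I" using d by (auto simp: K.m_inv_consistent[OF S'])
  next
    fix a b assume "a \<in> ?I" "b \<in> ?I"
    then show "a \<otimes>\<^bsub>?K\<^esub> b \<in> ?I"
      using corr_mult subgroup.m_closed[OF subL] subgroup.m_closed[OF S'] by fastforce
  qed
  moreover have "gconj ?K g a \<in> ?I" "g \<star>\<^bsub>K\<^esub> a \<in> ?I" if g: "g \<in> S" and a: "a \<in> ?I" for g a
  proof -
    obtain e where e: "e \<in> D" "(g, e) \<in> P" using tot g by blast
    obtain d where d: "a \<in> S" "d \<in> ?D'" "(a, d) \<in> P" using a by blast
    have "gconj ?L e d \<in> ?D'" using D.normal_gconj_closed[OF nor] e d by simp
    then have "gconj L e d \<in> ?D'" using e by (simp add: L.gconj_restrict[OF D'])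
    moreover have "gconj ?K g a \<in> S" using d g S.gconj_closed[of g a] by simp
    ultimately show "gconj ?K g a \<in> ?I"
      using corr_gconj[OF e(2) d(3)] g by (auto simp: K.gconj_restrict[OF S'])
    have "e \<star>\<^bsub>L\<^esub> d \<in> ?D'" using id e d by (simp add: mla_ideal_def)
    then show "g \<star>\<^bsub>K\<^esub> a \<in> ?I"
      using corr_star[OF e(2) d(3)] g d S by (auto simp: K.sub_mla_def)
  qed
  ultimately have "mla_ideal ?I ?K"
    by (auto simp: mla_ideal_def S.normal_inv_iff gconj_def)
  moreover have "lie_commutator ?K a b \<in> ?I" if ab: "a \<in> S" "b \<in> S" for a b
  proof -
    obtain d e where de: "d \<in> D" "(a, d) \<in> P" "e \<in> D" "(b, e) \<in> P" using tot ab by meson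
    have "lie_commutator ?L d e \<in> ?D'" using D.lie_commutator_in_derived de by simp
    then have "lie_commutator L d e \<in> ?D'" using de by (simp add: L.lie_commutator_restrict[OF D])
    moreover have "lie_commutator ?K a b \<in> S" using S.lie_commutator_closed ab by simp
    ultimately show ?thesis
      using corr_lie_commutator[OF de(2,4)] ab by (auto simp: K.lie_commutator_restrict[OF S])
  qed
  ultimately have "lie_derived ?K \<subseteq> ?I"
    unfolding lie_derived_def mla_genideal_def by (intro Inter_lower) auto
  then show ?thesis using t by blast
qed

lemma corr_lie_derived_series:
  "t \<in> lie_derived_series K k \<Longrightarrow> \<exists>d\<in>lie_derived_series L k. (t, d) \<in> P"
proof (induction k arbitrary: t)
  case 0
  then show ?case using corr_total corr_sub by fastforce
next
  case (Suc k)
  then show ?case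
    using corr_derived[OF K.sub_mla_lie_derived_series L.sub_mla_lie_derived_series Suc.IH] by simp
qed

end

section \<open>Presented multiplicative Lie algebras\<close>

lemma mla_terms_simps [simp]:
  "Gen x \<in> mla_terms S \<longleftrightarrow> x \<in> S"
  "TOne \<in> mla_terms S"
  "TMul s t \<in> mla_terms S \<longleftrightarrow> s \<in> mla_terms S \<and> t \<in> mla_terms S"
  "TInv s \<in> mla_terms S \<longleftrightarrow> s \<in> mla_terms S"
  "TStar s t \<in> mla_terms S \<longleftrightarrow> s \<in> mla_terms S \<and> t \<in> mla_terms S"
  "TConj s t \<in> mla_terms S \<longleftrightarrow> s \<in> mla_terms S \<and> t \<in> mla_terms S"
  by (auto simp: mla_terms_def TConj_def)

lemma mla_cong_in_terms: "(s, t) \<in> mla_cong S R \<Longrightarrow> s \<in> mla_terms S \<and> t \<in> mla_terms S"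
  by (induction rule: mla_cong.induct) auto

lemma equiv_mla_cong: "equiv (mla_terms S) (mla_cong S R)"
proof (rule equivI)
  show "mla_cong S R \<subseteq> mla_terms S \<times> mla_terms S"
    using mla_cong_in_terms by auto
  show "refl_on (mla_terms S) (mla_cong S R)"
    by (rule refl_onI) (rule mla_cong.refl)
  show "sym (mla_cong S R)"
    by (rule symI) (rule mla_cong.sym)
  show "trans (mla_cong S R)"
    by (rule transI) (rule mla_cong.trans)
qed

definition mla_class ::
  "'g set \<Rightarrow> ('g mla_term \<times> 'g mla_term) set \<Rightarrow> 'g mla_term \<Rightarrow> 'g mla_term set"
where
  "mla_class S R s = mla_cong S R `` {s}"

lemma mla_class_eqI: "(s, t) \<in> mla_cong S R \<Longrightarrow> mla_class S R s = mla_class S R t"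
  unfolding mla_class_def by (rule equiv_class_eq[OF equiv_mla_cong])

lemma mla_presented_carrier: "carrier (mla_presented S R) = mla_class S R ` mla_terms S"
  by (auto simp: mla_presented_def mla_class_def quotient_def)

lemma mla_presented_one: "\<one>\<^bsub>mla_presented S R\<^esub> = mla_class S R TOne"
  by (simp add: mla_presented_def mla_class_def)

lemma mla_presented_mult:
  assumes "s \<in> mla_terms S" "t \<in> mla_terms S"
  shows "mla_class S R s \<otimes>\<^bsub>mla_presented S R\<^esub> mla_class S R t = mla_class S R (TMul s t)"
proof -
  have "congruent2 (mla_cong S R) (mla_cong S R) (\<lambda>s t. mla_class S R (TMul s t))"
    by (rule congruent2I') (intro mla_class_eqI mla_cong.cong_mul)
  from UN_equiv_class2[OF equiv_mla_cong equiv_mla_cong this assms] show ?thesis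
    by (simp add: mla_presented_def mla_class_def)
qed

lemma mla_presented_star:
  assumes "s \<in> mla_terms S" "t \<in> mla_terms S"
  shows "mla_class S R s \<star>\<^bsub>mla_presented S R\<^esub> mla_class S R t = mla_class S R (TStar s t)"
proof -
  have "congruent2 (mla_cong S R) (mla_cong S R) (\<lambda>s t. mla_class S R (TStar s t))"
    by (rule congruent2I') (intro mla_class_eqI mla_cong.cong_star)
  from UN_equiv_class2[OF equiv_mla_cong equiv_mla_cong this assms] show ?thesis
    by (simp add: mla_presented_def mla_class_def)
qed

lemma mla_presented_group: "group (mla_presented S R)"
proof (rule groupI)
  fix x assume "x \<in> carrier (mla_presented S R)"
  then obtain s where s: "x = mla_class S R s" "s \<in> mla_terms S"
    by (auto simp: mla_presented_carrier)
  then show "\<one>\<^bsub>mla_presented S R\<^esub> \<otimes>\<^bsub>mla_presented S R\<^esub> x = x"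
    by (simp add: mla_presented_one mla_presented_mult mla_class_eqI mla_cong.mul_one)
  have "mla_class S R (TInv s) \<otimes>\<^bsub>mla_presented S R\<^esub> x = \<one>\<^bsub>mla_presented S R\<^esub>"
    using s by (simp add: mla_presented_one mla_presented_mult mla_class_eqI mla_cong.mul_inv)
  then show "\<exists>y\<in>carrier (mla_presented S R). y \<otimes>\<^bsub>mla_presented S R\<^esub> x = \<one>\<^bsub>mla_presented S R\<^esub>"
    using s by (auto simp: mla_presented_carrier)
next
  fix x y z
  assume "x \<in> carrier (mla_presented S R)" "y \<in> carrier (mla_presented S R)"
    "z \<in> carrier (mla_presented S R)"
  then show "x \<otimes>\<^bsub>mla_presented S R\<^esub> y \<otimes>\<^bsub>mla_presented S R\<^esub> z =
      x \<otimes>\<^bsub>mla_presented S R\<^esub> (y \<otimes>\<^bsub>mla_presented S R\<^esub> z)"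
    by (auto simp: mla_presented_carrier mla_presented_mult mla_cong.mul_assoc[THEN mla_class_eqI])
qed (auto simp: mla_presented_carrier mla_presented_mult mla_presented_one)

lemma mla_presented_inv:
  assumes "s \<in> mla_terms S"
  shows "inv\<^bsub>mla_presented S R\<^esub> mla_class S R s = mla_class S R (TInv s)"
  using assms
  by (intro group.inv_equality[OF mla_presented_group])
    (auto simp: mla_presented_carrier mla_presented_one mla_presented_mult
      intro!: mla_class_eqI mla_cong.mul_inv)

lemma mla_presented_gconj:
  assumes "s \<in> mla_terms S" "t \<in> mla_terms S"
  shows "gconj (mla_presented S R) (mla_class S R s) (mla_class S R t) = mla_class S R (TConj s t)"
  using assms by (simp add: gconj_def TConj_def mla_presented_inv mla_presented_mult)

lemma mla_presented_mla: "multiplicative_lie_algebra (mla_presented S R)"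
proof -
  interpret group "mla_presented S R" by (rule mla_presented_group)
  show ?thesis
    by unfold_locales
      (auto simp: mla_presented_carrier mla_presented_one mla_presented_mult mla_presented_star
        mla_presented_gconj mla_cong.star_self[THEN mla_class_eqI] mla_cong.star_mul[THEN mla_class_eqI]
        mla_cong.mul_star[THEN mla_class_eqI] mla_cong.jacobi[THEN mla_class_eqI]
        mla_cong.conj_star[THEN mla_class_eqI, symmetric])
qed

section \<open>Pairs generated under the group operations\<close>

text \<open>For \<open>Z\<close> inside the two carriers this is the subgroup of the direct product
  generated by \<open>Z\<close>. Star is left out on purpose, so that inductions over it only have
  group cases.\<close>

inductive_set pair_generate ::
  "('a, 'm) monoid_scheme \<Rightarrow> ('b, 'k) monoid_scheme \<Rightarrow> ('a \<times> 'b) set \<Rightarrow> ('a \<times> 'b) set"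
  for K :: "('a, 'm) monoid_scheme" and L :: "('b, 'k) monoid_scheme" and Z :: "('a \<times> 'b) set"
where
  base: "(s, d) \<in> Z \<Longrightarrow> (s, d) \<in> pair_generate K L Z"
| one: "(\<one>\<^bsub>K\<^esub>, \<one>\<^bsub>L\<^esub>) \<in> pair_generate K L Z"
| mult: "\<lbrakk>(s, d) \<in> pair_generate K L Z; (t, e) \<in> pair_generate K L Z\<rbrakk> \<Longrightarrow>
    (s \<otimes>\<^bsub>K\<^esub> t, d \<otimes>\<^bsub>L\<^esub> e) \<in> pair_generate K L Z"
| inv: "(s, d) \<in> pair_generate K L Z \<Longrightarrow> (inv\<^bsub>K\<^esub> s, inv\<^bsub>L\<^esub> d) \<in> pair_generate K L Z"

locale mla_pair_generators =
  K: multiplicative_lie_algebra K + L: multiplicative_lie_algebra L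
  for K :: "('a, 'm) mla_scheme" and L :: "('b, 'k) mla_scheme" and Z :: "('a \<times> 'b) set" +
  assumes gens_sub: "(s, d) \<in> Z \<Longrightarrow> s \<in> carrier K \<and> d \<in> carrier L"
    and gens_star: "\<lbrakk>(s, d) \<in> Z; (t, e) \<in> Z\<rbrakk> \<Longrightarrow> (s \<star>\<^bsub>K\<^esub> t, d \<star>\<^bsub>L\<^esub> e) \<in> Z"
begin

abbreviation "PZ \<equiv> pair_generate K L Z"

lemma pair_carrier: "(s, d) \<in> PZ \<Longrightarrow> s \<in> carrier K \<and> d \<in> carrier L"
  by (induction rule: pair_generate.induct) (auto dest: gens_sub)

lemma pair_gconj: "\<lbrakk>(s, d) \<in> PZ; (t, e) \<in> PZ\<rbrakk> \<Longrightarrow> (gconj K s t, gconj L d e) \<in> PZ"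
  by (simp add: gconj_def pair_generate.mult pair_generate.inv)

text \<open>Star expands over products and inverses by the same word in both coordinates, so closure
  of \<open>Z\<close> under star passes to the generated group, first in the right argument and
  then, in \<open>pair_star\<close>, in the left one.\<close>

lemma pair_star_gen:
  assumes "(t, e) \<in> PZ" and Z: "(s, d) \<in> Z"
  shows "(s \<star>\<^bsub>K\<^esub> t, d \<star>\<^bsub>L\<^esub> e) \<in> PZ"
  using assms(1)
proof (induction rule: pair_generate.induct)
  case (base t e)
  then show ?case using gens_star Z pair_generate.base by metis
next
  case one
  then show ?case using gens_sub Z by (simp add: pair_generate.one)
next
  case (mult t e t' e')
  then show ?case
    using gens_sub[OF Z] pair_carrier pair_gconj
    by (auto simp: K.star_mult L.star_mult intro!: pair_generate.mult)
next
  case (inv t e)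
  then show ?case
    using gens_sub[OF Z] pair_carrier[OF inv.hyps]
      pair_gconj[OF pair_generate.inv[OF inv.hyps] pair_generate.inv[OF inv.IH]]
    by (simp add: K.star_inv L.star_inv)
qed

lemma pair_star:
  assumes "(s, d) \<in> PZ" and t: "(t, e) \<in> PZ"
  shows "(s \<star>\<^bsub>K\<^esub> t, d \<star>\<^bsub>L\<^esub> e) \<in> PZ"
  using assms(1)
proof (induction rule: pair_generate.induct)
  case (base s d)
  then show ?case using pair_star_gen t by blast
next
  case one
  then show ?case using pair_carrier[OF t] by (simp add: pair_generate.one)
next
  case (mult s d s' d')
  then show ?case
    using pair_carrier[OF t] pair_carrier pair_gconj
    by (auto simp: K.mult_star L.mult_star intro!: pair_generate.mult)
next
  case (inv s d)
  then show ?case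
    using pair_carrier[OF t] pair_carrier[OF inv.hyps]
      pair_gconj[OF pair_generate.inv[OF inv.hyps] pair_generate.inv[OF inv.IH]]
    by (simp add: K.inv_star L.inv_star)
qed

lemma mla_correspondence_pair_generate:
  assumes "\<And>t. t \<in> carrier K \<Longrightarrow> \<exists>d. (t, d) \<in> PZ"
  shows "mla_correspondence K L PZ"
  by unfold_locales (use assms pair_carrier pair_star in \<open>auto intro: pair_generate.intros\<close>)

end

section \<open>Compatible actions\<close>

context mla_action
begin

lemma act_auto: "x \<in> carrier G \<Longrightarrow> aG x \<in> auto H"
  using act_hom by (auto simp: hom_def AutoGroup_def BijGroup_def)

lemma act_closed [simp]: "\<lbrakk>x \<in> carrier G; y \<in> carrier H\<rbrakk> \<Longrightarrow> aG x y \<in> carrier H"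
  using act_auto[of x] by (auto simp: auto_def hom_def)

lemma act_mult:
  "\<lbrakk>x \<in> carrier G; y \<in> carrier H; y' \<in> carrier H\<rbrakk> \<Longrightarrow> aG x (y \<otimes>\<^bsub>H\<^esub> y') = aG x y \<otimes>\<^bsub>H\<^esub> aG x y'"
  using act_auto[of x] by (auto simp: auto_def hom_def)

lemma act_comp:
  "\<lbrakk>x \<in> carrier G; x' \<in> carrier G; y \<in> carrier H\<rbrakk> \<Longrightarrow> aG (x \<otimes>\<^bsub>G\<^esub> x') y = aG x (aG x' y)"
  using act_hom act_auto[of x] act_auto[of x']
  by (auto simp: hom_def AutoGroup_def BijGroup_def auto_def compose_eq)

lemma act_hom_axioms: "x \<in> carrier G \<Longrightarrow> group_hom H H (aG x)"
  using act_auto[of x] by unfold_locales (simp add: auto_def)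

lemma act_one [simp]: "x \<in> carrier G \<Longrightarrow> aG x \<one>\<^bsub>H\<^esub> = \<one>\<^bsub>H\<^esub>"
  using group_hom.hom_one[OF act_hom_axioms] .

lemma act_inv: "\<lbrakk>x \<in> carrier G; y \<in> carrier H\<rbrakk> \<Longrightarrow> aG x (inv\<^bsub>H\<^esub> y) = inv\<^bsub>H\<^esub> (aG x y)"
  using group_hom.hom_inv[OF act_hom_axioms] .

lemma one_act [simp]:
  assumes "y \<in> carrier H" shows "aG \<one>\<^bsub>G\<^esub> y = y"
proof -
  \<comment> \<open>The unit acts by an idempotent injective map, which must be the
    identity.\<close>
  have "aG \<one>\<^bsub>G\<^esub> (aG \<one>\<^bsub>G\<^esub> y) = aG \<one>\<^bsub>G\<^esub> y"
    using act_comp[of "\<one>\<^bsub>G\<^esub>" "\<one>\<^bsub>G\<^esub>" y] assms by simp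
  moreover have "inj_on (aG \<one>\<^bsub>G\<^esub>) (carrier H)"
    using act_auto[of "\<one>\<^bsub>G\<^esub>"] by (simp add: auto_def Bij_def bij_betw_def)
  ultimately show ?thesis
    using assms by (simp add: inj_on_eq_iff)
qed

lemma act_inv_cancel [simp]:
  "\<lbrakk>x \<in> carrier G; y \<in> carrier H\<rbrakk> \<Longrightarrow> aG (inv\<^bsub>G\<^esub> x) (aG x y) = y"
  "\<lbrakk>x \<in> carrier G; y \<in> carrier H\<rbrakk> \<Longrightarrow> aG x (aG (inv\<^bsub>G\<^esub> x) y) = y"
  by (simp_all flip: act_comp)

lemma act_gconj:
  "\<lbrakk>x \<in> carrier G; y \<in> carrier H; y' \<in> carrier H\<rbrakk> \<Longrightarrow> aG x (gconj H y y') = gconj H (aG x y) (aG x y')"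
  by (simp add: gconj_def act_mult act_inv)

declare br_closed [simp]

end

context compatible_mla_actions
begin

lemma triv_act_H:
  assumes "g \<in> carrier G" "h \<in> carrier H" "h' \<in> carrier H"
  shows "aG (bH h g) h' = gconj H (inv\<^bsub>H\<^esub> (bG g h)) h'"
  using compat_triv_H[OF assms] assms
  by (metis GH.H.gconj_inv_cancel(1) GH.act_closed GH.br_closed HG.br_closed)

lemma triv_act_G:
  assumes "g \<in> carrier G" "h \<in> carrier H" "g' \<in> carrier G"
  shows "aH (bG g h) g' = gconj G (inv\<^bsub>G\<^esub> (bH h g)) g'"
  using compat_triv_G[of g "gconj G (inv\<^bsub>G\<^esub> (bH h g)) g'" h] assms by simp

text \<open>Only condition (3) is not visibly symmetric, since the exchange reverses its two
  factors. The order is immaterial because the two maps are mutually inverse.\<close>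

lemma swap: "compatible_mla_actions H G aH aG bH bG"
proof unfold_locales
  fix g g' h assume "g \<in> carrier H" "h \<in> carrier G" "g' \<in> carrier H"
  then show "aG (bH g h) (gconj H (bG h g) g') = g'"
    by (simp add: triv_act_H)
next
  fix g h h' assume "g \<in> carrier H" "h \<in> carrier G" "h' \<in> carrier G"
  then show "gconj G (bH g h) (aH (bG h g) h') = h'"
    by (simp add: triv_act_G)
qed (rule compat_act_G compat_act_H compat_br_G compat_br_H compat_equivar_G compat_equivar_H
  compat_disp_G compat_disp_H; assumption)+

text \<open>The commutator \<open>[x,y] = x y x\<inverse> y\<inverse>\<close> read as an element of \<open>H\<close> and of \<open>G\<close>; both readings act
  like this word.\<close>

definition comm_H :: "'a \<Rightarrow> 'b \<Rightarrow> 'b" where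
  "comm_H x y = aG x y \<otimes>\<^bsub>H\<^esub> inv\<^bsub>H\<^esub> y"

definition comm_G :: "'a \<Rightarrow> 'b \<Rightarrow> 'a" where
  "comm_G x y = x \<otimes>\<^bsub>G\<^esub> aH y (inv\<^bsub>G\<^esub> x)"

lemma comm_closed [simp]:
  "\<lbrakk>x \<in> carrier G; y \<in> carrier H\<rbrakk> \<Longrightarrow> comm_H x y \<in> carrier H"
  "\<lbrakk>x \<in> carrier G; y \<in> carrier H\<rbrakk> \<Longrightarrow> comm_G x y \<in> carrier G"
  by (simp_all add: comm_H_def comm_G_def)

lemma act_act_H:
  assumes "x \<in> carrier G" "y \<in> carrier H" "g \<in> carrier G"
  shows "aH (aG x y) (gconj G x g) = gconj G x (aH y g)"
  using assms compat_act_G[of x "gconj G x g" y] by simp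

lemma act_act_G:
  assumes "x \<in> carrier G" "y \<in> carrier H" "h \<in> carrier H"
  shows "aG (aH y x) (gconj H y h) = gconj H y (aG x h)"
  using assms compat_act_H[of x y "gconj H y h"] by simp

lemma comm_H_act_G:
  assumes "x \<in> carrier G" "y \<in> carrier H" "g \<in> carrier G"
  shows "aH (comm_H x y) g = gconj G x (aH y (gconj G (inv\<^bsub>G\<^esub> x) (aH (inv\<^bsub>H\<^esub> y) g)))"
  using assms by (simp add: comm_H_def GH.H.m_closed HG.act_comp compat_act_G)

lemma comm_H_act_H:
  assumes "x \<in> carrier G" "y \<in> carrier H" "h \<in> carrier H"
  shows "gconj H (comm_H x y) h = aG x (gconj H y (aG (inv\<^bsub>G\<^esub> x) (gconj H (inv\<^bsub>H\<^esub> y) h)))"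
  using assms by (simp add: comm_H_def GH.act_gconj GH.H.gconj_comp)

lemma comm_G_act_G:
  assumes "x \<in> carrier G" "y \<in> carrier H" "g \<in> carrier G"
  shows "gconj G (comm_G x y) g = aH (comm_H x y) g"
  using assms by (simp add: comm_G_def comm_H_act_G HG.act_gconj GH.G.gconj_comp HG.act_inv gconj_def
      HG.act_mult GH.G.group_simps)

text \<open>Expanding \<open>\<beta> (x x') (y y')\<close> in the two possible orders, as for the nonabelian tensor
  product of Brown and Loday.\<close>

lemma crossed_pairing_gconj:
  fixes L :: "('c, 'l) monoid_scheme" and \<beta> :: "'a \<Rightarrow> 'b \<Rightarrow> 'c"
  assumes "group L"
    and closed: "\<And>x y. \<lbrakk>x \<in> carrier G; y \<in> carrier H\<rbrakk> \<Longrightarrow> \<beta> x y \<in> carrier L"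
    and right: "\<And>x y y'. \<lbrakk>x \<in> carrier G; y \<in> carrier H; y' \<in> carrier H\<rbrakk> \<Longrightarrow>
      \<beta> x (y \<otimes>\<^bsub>H\<^esub> y') = \<beta> x y \<otimes>\<^bsub>L\<^esub> \<beta> (aH y x) (gconj H y y')"
    and left: "\<And>x x' y. \<lbrakk>x \<in> carrier G; x' \<in> carrier G; y \<in> carrier H\<rbrakk> \<Longrightarrow>
      \<beta> (x \<otimes>\<^bsub>G\<^esub> x') y = \<beta> (gconj G x x') (aG x y) \<otimes>\<^bsub>L\<^esub> \<beta> x y"
    and x: "x \<in> carrier G" and y: "y \<in> carrier H" and g: "g \<in> carrier G" and h: "h \<in> carrier H"
  shows "gconj L (\<beta> x y) (\<beta> g h) = \<beta> (aH (comm_H x y) g) (gconj H (comm_H x y) h)"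
proof -
  interpret L: group L by fact
  \<comment> \<open>Chosen so that the corner \<open>?d\<close> of the second expansion becomes
    \<open>\<beta> g h\<close>; the corner \<open>?c\<close> of the first then carries the action of
    the commutator word.\<close>
  define x' where "x' = gconj G (inv\<^bsub>G\<^esub> x) (aH (inv\<^bsub>H\<^esub> y) g)"
  define y' where "y' = aG (inv\<^bsub>G\<^esub> x) (gconj H (inv\<^bsub>H\<^esub> y) h)"
  have x': "x' \<in> carrier G" and y': "y' \<in> carrier H"
    using x y g h by (simp_all add: x'_def y'_def)
  let ?a = "\<beta> (gconj G x x') (aG x y)" and ?b = "\<beta> (aH y x) (gconj H y y')"
  let ?c = "\<beta> (gconj G x (aH y x')) (aG x (gconj H y y'))"
  let ?d = "\<beta> (aH y (gconj G x x')) (gconj H y (aG x y'))"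
  note c = closed x y x' y'
  have "\<beta> (x \<otimes>\<^bsub>G\<^esub> x') (y \<otimes>\<^bsub>H\<^esub> y') = \<beta> (gconj G x x') (aG x y \<otimes>\<^bsub>H\<^esub> aG x y') \<otimes>\<^bsub>L\<^esub> \<beta> x (y \<otimes>\<^bsub>H\<^esub> y')"
    using x y x' y' by (simp add: left GH.act_mult)
  also have "\<dots> = (?a \<otimes>\<^bsub>L\<^esub> ?c) \<otimes>\<^bsub>L\<^esub> (\<beta> x y \<otimes>\<^bsub>L\<^esub> ?b)"
    using x y x' y' by (simp add: right act_act_H GH.act_gconj)
  finally have 1: "\<beta> (x \<otimes>\<^bsub>G\<^esub> x') (y \<otimes>\<^bsub>H\<^esub> y') = (?a \<otimes>\<^bsub>L\<^esub> ?c) \<otimes>\<^bsub>L\<^esub> (\<beta> x y \<otimes>\<^bsub>L\<^esub> ?b)" .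
  have "\<beta> (x \<otimes>\<^bsub>G\<^esub> x') (y \<otimes>\<^bsub>H\<^esub> y') = \<beta> (x \<otimes>\<^bsub>G\<^esub> x') y \<otimes>\<^bsub>L\<^esub> \<beta> (aH y x \<otimes>\<^bsub>G\<^esub> aH y x') (gconj H y y')"
    using x y x' y' by (simp add: right HG.act_mult)
  also have "\<dots> = (?a \<otimes>\<^bsub>L\<^esub> \<beta> x y) \<otimes>\<^bsub>L\<^esub> (?d \<otimes>\<^bsub>L\<^esub> ?b)"
    using x y x' y' by (simp add: left act_act_G HG.act_gconj)
  finally have "?a \<otimes>\<^bsub>L\<^esub> (?c \<otimes>\<^bsub>L\<^esub> \<beta> x y \<otimes>\<^bsub>L\<^esub> ?b) = ?a \<otimes>\<^bsub>L\<^esub> (\<beta> x y \<otimes>\<^bsub>L\<^esub> ?d \<otimes>\<^bsub>L\<^esub> ?b)"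
    using 1 c by (simp add: L.m_assoc)
  then have "?c \<otimes>\<^bsub>L\<^esub> \<beta> x y = \<beta> x y \<otimes>\<^bsub>L\<^esub> ?d"
    using c by simp
  moreover have "?d = \<beta> g h"
    using x y g h by (simp add: x'_def y'_def)
  moreover have "?c = \<beta> (aH (comm_H x y) g) (gconj H (comm_H x y) h)"
    using x y g h by (simp add: x'_def y'_def comm_H_act_G comm_H_act_H)
  ultimately show ?thesis
    using x y g h by (simp add: gconj_def L.inv_solve_right' closed)
qed

end

section \<open>The bracket map and the subgroup generated by its values\<close>

context compatible_mla_actions
begin

lemma br_one_left [simp]:
  assumes "y \<in> carrier H" shows "bG \<one>\<^bsub>G\<^esub> y = \<one>\<^bsub>H\<^esub>"
  using GH.br_mult_left[of "\<one>\<^bsub>G\<^esub>" "\<one>\<^bsub>G\<^esub>" y] assms by simp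

lemma br_inv_left:
  assumes "x \<in> carrier G" "y \<in> carrier H"
  shows "bG (inv\<^bsub>G\<^esub> x) (aG x y) = inv\<^bsub>H\<^esub> (bG x y)"
  using GH.br_mult_left[of x "inv\<^bsub>G\<^esub> x" y] assms
  by (simp add: GH.G.gconj_inv GH.H.inv_equality)

lemma br_crossed_hom:
  assumes "x \<in> carrier G" "y \<in> carrier H" "y' \<in> carrier H"
  shows "bG x (y \<otimes>\<^bsub>H\<^esub> y') = bG x y \<otimes>\<^bsub>H\<^esub> gconj H y (bG x y')"
  using assms by (simp add: GH.br_mult_right compat_equivar_H)

lemma bracket_gconj:
  assumes "x \<in> carrier G" "y \<in> carrier H"
  shows "h \<in> carrier H \<Longrightarrow> aG (inv\<^bsub>G\<^esub> (bH y x)) h = gconj H (bG x y) h"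
    and "g \<in> carrier G \<Longrightarrow> aH (bG x y) g = gconj G (inv\<^bsub>G\<^esub> (bH y x)) g"
proof -
  assume h: "h \<in> carrier H"
  have "aG (bH y x) (gconj H (bG x y) h) = h"
    using assms h triv_act_H[of x y "gconj H (bG x y) h"] by simp
  then show "aG (inv\<^bsub>G\<^esub> (bH y x)) h = gconj H (bG x y) h"
    using assms h by (metis GH.act_inv_cancel(1) GH.H.gconj_closed GH.br_closed HG.br_closed)
next
  assume "g \<in> carrier G"
  with assms show "aH (bG x y) g = gconj G (inv\<^bsub>G\<^esub> (bH y x)) g"
    by (rule triv_act_G)
qed

abbreviation "brs_H \<equiv> bracket_subgroup G H bG"
abbreviation "brs_G \<equiv> bracket_subgroup H G bH"

lemma bracket_mem: "\<lbrakk>x \<in> carrier G; y \<in> carrier H\<rbrakk> \<Longrightarrow> bG x y \<in> brs_H"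
  unfolding bracket_subgroup_def by (rule generate.incl) blast

lemma bracket_normal: "brs_H \<lhd> H"
  unfolding bracket_subgroup_def
proof (rule GH.H.normal_generateI)
  fix h z assume "h \<in> {bG g h | g h. g \<in> carrier G \<and> h \<in> carrier H}" and z: "z \<in> carrier H"
  then obtain x y where "x \<in> carrier G" "y \<in> carrier H" "h = bG x y" by blast
  then have "z \<otimes>\<^bsub>H\<^esub> h \<otimes>\<^bsub>H\<^esub> inv\<^bsub>H\<^esub> z = bG (aH z x) (gconj H z y)"
    using z compat_equivar_H[of x z y] by (simp add: gconj_def)
  moreover have "aH z x \<in> carrier G" "gconj H z y \<in> carrier H"
    using z \<open>x \<in> _\<close> \<open>y \<in> _\<close> by simp_all
  ultimately show "z \<otimes>\<^bsub>H\<^esub> h \<otimes>\<^bsub>H\<^esub> inv\<^bsub>H\<^esub> z \<in> {bG g h | g h. g \<in> carrier G \<and> h \<in> carrier H}"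
    by blast
qed auto

lemmas bracket_subgroup = normal_imp_subgroup[OF bracket_normal]
lemmas bracket_carrier = subgroup.mem_carrier[OF bracket_subgroup]

text \<open>The bracket is itself a crossed pairing, with values in \<open>H\<close>, so
  \<open>crossed_pairing_gconj\<close> applies to it; equivariance pulls the commutator out of the
  resulting bracket.\<close>

lemma bracket_gconj_bracket:
  assumes "x \<in> carrier G" "y \<in> carrier H" "g \<in> carrier G" "h \<in> carrier H"
  shows "gconj H (bG x y) (bG g h) = gconj H (comm_H x y) (bG g h)"
  using assms
    crossed_pairing_gconj[of H bG, OF GH.H.is_group GH.br_closed GH.br_mult_right GH.br_mult_left]
  by (simp add: compat_equivar_H)

text \<open>Conjugation by \<open>\<langle>x,y\<rangle>\<close> and by \<open>[x,y]\<close> differ in general, but not on \<open>\<langle>G,H\<rangle>\<close>.\<close>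

lemma bracket_gconj_comm:
  assumes xy: "x \<in> carrier G" "y \<in> carrier H" and "b \<in> brs_H"
  shows "gconj H (bG x y) b = gconj H (comm_H x y) b"
  using \<open>b \<in> brs_H\<close>[unfolded bracket_subgroup_def]
proof (induction rule: generate.induct)
  case (inv h)
  then show ?case using xy bracket_gconj_bracket by (auto simp: GH.H.gconj_inv)
next
  case (eng h1 h2)
  then show ?case
    using xy bracket_carrier[unfolded bracket_subgroup_def] by (simp add: GH.H.gconj_mult)
qed (use xy bracket_gconj_bracket in auto)

text \<open>A generator \<open>bG x y\<close> acts like the inverse of \<open>bH y x\<close> on both
  groups, and these elements of \<open>G\<close> multiply along words. The purpose is to see that
  \<open>brs_H\<close> preserves every normal subgroup of \<open>G\<close>, and to use equivariance
  under \<open>G\<close> with the same \<open>k\<close>.\<close>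

lemma bracket_acts_inner:
  assumes "v \<in> brs_H"
  obtains k where "k \<in> carrier G" "\<And>g. g \<in> carrier G \<Longrightarrow> aH v g = gconj G k g"
    "\<And>h. h \<in> carrier H \<Longrightarrow> gconj H v h = aG k h"
proof -
  have "\<exists>k\<in>carrier G. (\<forall>g\<in>carrier G. aH v g = gconj G k g) \<and> (\<forall>h\<in>carrier H. gconj H v h = aG k h)"
    using assms[unfolded bracket_subgroup_def]
  proof (induction rule: generate.induct)
    case one
    show ?case by (rule bexI[of _ "\<one>\<^bsub>G\<^esub>"]) simp_all
  next
    case (incl v)
    then obtain x y where xy: "x \<in> carrier G" "y \<in> carrier H" "v = bG x y" by blast
    then show ?case
      by (intro bexI[of _ "inv\<^bsub>G\<^esub> (bH y x)"]) (simp_all add: bracket_gconj)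
  next
    case (inv v)
    then obtain x y where xy: "x \<in> carrier G" "y \<in> carrier H" "v = bG x y" by blast
    have "aH (inv\<^bsub>H\<^esub> v) g = gconj G (bH y x) g" if "g \<in> carrier G" for g
    proof -
      have "aH v (gconj G (bH y x) g) = g"
        using xy that by (simp add: bracket_gconj)
      then show ?thesis
        using xy that HG.act_inv_cancel(1)[of v "gconj G (bH y x) g"] by simp
    qed
    then show ?case
      using xy by (intro bexI[of _ "bH y x"]) (simp_all add: triv_act_H)
  next
    case (eng v v')
    then obtain k k' where "k \<in> carrier G" "k' \<in> carrier G"
      "\<forall>g\<in>carrier G. aH v g = gconj G k g" "\<forall>h\<in>carrier H. gconj H v h = aG k h"
      "\<forall>g\<in>carrier G. aH v' g = gconj G k' g" "\<forall>h\<in>carrier H. gconj H v' h = aG k' h"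
      by blast
    moreover have "v \<in> carrier H" "v' \<in> carrier H"
      using eng.hyps bracket_carrier[unfolded bracket_subgroup_def] by auto
    ultimately show ?case
      by (intro bexI[of _ "k \<otimes>\<^bsub>G\<^esub> k'"])
        (simp_all add: HG.act_comp GH.act_comp GH.H.gconj_comp GH.G.gconj_comp)
  qed
  then show thesis using that by blast
qed

text \<open>Condition (5) turns the left side into \<open>bG (comm_G x y) h\<close>, which splits by
  the left product rule into a factor computed below and \<open>bG x h\<close>.\<close>

lemma comm_star:
  assumes x: "x \<in> carrier G" and y: "y \<in> carrier H" and h: "h \<in> carrier H"
  shows "comm_H x y \<star>\<^bsub>H\<^esub> h = gcomm H (bG x y) h"
proof -
  let ?D = "bG x y" and ?D' = "bG x h" and ?k = "gconj H (inv\<^bsub>H\<^esub> y) h"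
  let ?W = "inv\<^bsub>H\<^esub> ?D \<otimes>\<^bsub>H\<^esub> (?D' \<otimes>\<^bsub>H\<^esub> gconj H h ?D)"
  have W: "?W \<in> brs_H"
    using assms bracket_mem bracket_subgroup GH.H.normal_gconj_closed[OF bracket_normal]
    by (simp add: subgroup.m_closed subgroup.m_inv_closed)
  \<comment> \<open>Since \<open>y \<otimes> ?k\<close> and \<open>h \<otimes> y\<close> agree in
    \<open>H\<close>, expanding the bracket of \<open>x\<close> with each determines
    \<open>bG x ?k\<close>.\<close>
  have "?D \<otimes>\<^bsub>H\<^esub> gconj H y (bG x ?k) = bG x (y \<otimes>\<^bsub>H\<^esub> ?k)"
    using assms by (simp add: br_crossed_hom)
  also have "y \<otimes>\<^bsub>H\<^esub> ?k = h \<otimes>\<^bsub>H\<^esub> y"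
    using assms by (simp add: gconj_def GH.H.group_simps)
  also have "bG x (h \<otimes>\<^bsub>H\<^esub> y) = ?D' \<otimes>\<^bsub>H\<^esub> gconj H h ?D"
    using assms by (simp add: br_crossed_hom)
  finally have "gconj H y (bG x ?k) = ?W"
    using assms by (simp add: GH.H.inv_solve_left)
  then have k: "bG x ?k = gconj H (inv\<^bsub>H\<^esub> y) ?W"
    using assms by (metis GH.H.gconj_inv_cancel(1) GH.H.gconj_closed GH.H.inv_closed GH.br_closed)
  \<comment> \<open>Both entries are images under the element \<open>aG x y\<close> of
    \<open>H\<close>: the left one by compatibility of the actions, the right one because
    \<open>h\<close> is the \<open>y\<close>-conjugate of \<open>?k\<close>. Equivariance then pulls
    \<open>aG x y\<close> out.\<close>
  have "bG (gconj G x (aH y (inv\<^bsub>G\<^esub> x))) (aG x h)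
      = bG (aH (aG x y) (inv\<^bsub>G\<^esub> x)) (gconj H (aG x y) (aG x ?k))"
    using assms act_act_H[of x y "inv\<^bsub>G\<^esub> x"] by (simp add: GH.G.gconj_inv flip: GH.act_gconj)
  also have "\<dots> = gconj H (aG x y) (inv\<^bsub>H\<^esub> (bG x ?k))"
    using assms by (simp add: br_inv_left flip: compat_equivar_H)
  also have "\<dots> = gconj H (comm_H x y) (inv\<^bsub>H\<^esub> ?W)"
    using assms k by (simp add: comm_H_def GH.H.gconj_comp GH.H.gconj_inv)
  \<comment> \<open>The exchange of commutator and bracket is legitimate because \<open>?W\<close>
    lies in \<open>brs_H\<close>.\<close>
  also have "\<dots> = gconj H ?D (inv\<^bsub>H\<^esub> ?W)"
    using bracket_gconj_comm[OF x y subgroup.m_inv_closed[OF bracket_subgroup W]] by simp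
  finally have "bG (comm_G x y) h = gconj H ?D (inv\<^bsub>H\<^esub> ?W) \<otimes>\<^bsub>H\<^esub> ?D'"
    using assms by (simp add: comm_G_def GH.br_mult_left)
  also have "\<dots> = gcomm H ?D h"
    using assms by (simp add: GH.H.gcomm_eq' gconj_def[of H ?D] GH.H.group_simps)
  finally show ?thesis
    using assms by (simp add: comm_H_def comm_G_def compat_disp_H)
qed

lemma bracket_star:
  assumes "x \<in> carrier G" "y \<in> carrier H" "h \<in> carrier H"
  shows "bG x y \<star>\<^bsub>H\<^esub> h = bG (inv\<^bsub>G\<^esub> (bH y x)) h"
  using assms by (simp add: compat_br_H)

text \<open>Both sides equal the group commutator of \<open>bG x y\<close> and
  \<open>bG x' y'\<close>. The right side has the form of the star relation of the tensor product,
  so the pairs of \<open>x \<otimes> y\<close> with its commutator are closed under star.\<close>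

lemma comm_star_comm:
  assumes "x \<in> carrier G" "y \<in> carrier H" "x' \<in> carrier G" "y' \<in> carrier H"
  shows "comm_H x y \<star>\<^bsub>H\<^esub> comm_H x' y' = comm_H (inv\<^bsub>G\<^esub> (bH y x)) (bG x' y')"
proof -
  have "comm_H x y \<star>\<^bsub>H\<^esub> comm_H x' y' = bG x y \<otimes>\<^bsub>H\<^esub> inv\<^bsub>H\<^esub> (gconj H (bG x' y') (bG x y))"
    using assms by (simp add: comm_star GH.H.gcomm_eq' bracket_gconj_bracket)
  also have "\<dots> = gconj H (bG x y) (bG x' y') \<otimes>\<^bsub>H\<^esub> inv\<^bsub>H\<^esub> (bG x' y')"
    using assms GH.H.gcomm_eq GH.H.gcomm_eq' by simp
  finally show ?thesis
    using assms by (simp add: comm_H_def bracket_gconj)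
qed

end

section \<open>The displacement ideal\<close>

context compatible_mla_actions
begin

interpretation sw: compatible_mla_actions H G aH aG bH bG
  by (rule swap)

abbreviation "disp \<equiv> lie_displacement G H aH bH"

lemma displacement_alt:
  "disp = generate G {inv\<^bsub>G\<^esub> (bH h g) \<otimes>\<^bsub>G\<^esub> sw.comm_H h g | h g. h \<in> carrier H \<and> g \<in> carrier G}"
  by (simp add: lie_displacement_def sw.comm_H_def)

lemma displacement_mem:
  "\<lbrakk>h \<in> carrier H; g \<in> carrier G\<rbrakk> \<Longrightarrow> inv\<^bsub>G\<^esub> (bH h g) \<otimes>\<^bsub>G\<^esub> sw.comm_H h g \<in> disp"
  unfolding displacement_alt by (rule generate.incl) blast

lemma displacement_normal: "disp \<lhd> G"
  unfolding displacement_alt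
proof (rule GH.G.normal_generateI)
  let ?S = "{inv\<^bsub>G\<^esub> (bH h g) \<otimes>\<^bsub>G\<^esub> sw.comm_H h g | h g. h \<in> carrier H \<and> g \<in> carrier G}"
  show "?S \<subseteq> carrier G" by auto
  fix u z assume "u \<in> ?S" and z: "z \<in> carrier G"
  then obtain h g where hg: "h \<in> carrier H" "g \<in> carrier G"
    "u = inv\<^bsub>G\<^esub> (bH h g) \<otimes>\<^bsub>G\<^esub> sw.comm_H h g" by blast
  then have "gconj G z u = inv\<^bsub>G\<^esub> (bH (aG z h) (gconj G z g)) \<otimes>\<^bsub>G\<^esub> sw.comm_H (aG z h) (gconj G z g)"
    using z by (simp add: GH.G.gconj_mult GH.G.gconj_inv compat_equivar_G sw.comm_H_def act_act_H)
  moreover have "aG z h \<in> carrier H" "gconj G z g \<in> carrier G"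
    using hg z by simp_all
  ultimately show "z \<otimes>\<^bsub>G\<^esub> u \<otimes>\<^bsub>G\<^esub> inv\<^bsub>G\<^esub> z \<in> ?S"
    unfolding gconj_def[symmetric] by blast
qed

lemmas displacement_subgroup = normal_imp_subgroup[OF displacement_normal]
lemmas displacement_carrier = subgroup.mem_carrier[OF displacement_subgroup]
lemmas displacement_gconj = GH.G.normal_gconj_closed[OF displacement_normal]

text \<open>Up to conjugation the star with \<open>z\<close> is again a generator, namely the one
  for the pair \<open>?k\<close>, \<open>z\<close>: condition (2) produces its bracket
  \<open>?E\<close>, and \<open>comm_star\<close> its commutator \<open>?c\<close>, since
  \<open>?k\<close> acts on \<open>G\<close> as conjugation by \<open>?D\<close>.\<close>

lemma displacement_gen_star:
  assumes h: "h \<in> carrier H" and g: "g \<in> carrier G" and z: "z \<in> carrier G"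
  shows "(inv\<^bsub>G\<^esub> (bH h g) \<otimes>\<^bsub>G\<^esub> sw.comm_H h g) \<star>\<^bsub>G\<^esub> z \<in> disp"
proof -
  let ?D = "bH h g" and ?k = "inv\<^bsub>H\<^esub> (bG g h)"
  let ?E = "bH ?k z" and ?c = "gcomm G ?D z"
  have c: "?c \<in> carrier G" using assms by (simp add: gcomm_def)
  have "sw.comm_H ?k z = ?c"
    using assms by (simp add: sw.comm_H_def sw.bracket_gconj GH.G.gcomm_eq)
  then have "inv\<^bsub>G\<^esub> ?E \<otimes>\<^bsub>G\<^esub> ?c \<in> disp"
    using assms displacement_mem[of ?k z] by simp
  then have "gconj G (inv\<^bsub>G\<^esub> ?D) (gconj G ?E (inv\<^bsub>G\<^esub> ?E \<otimes>\<^bsub>G\<^esub> ?c)) \<in> disp"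
    using assms by (intro displacement_gconj) simp_all
  also have "gconj G ?E (inv\<^bsub>G\<^esub> ?E \<otimes>\<^bsub>G\<^esub> ?c) = ?c \<otimes>\<^bsub>G\<^esub> inv\<^bsub>G\<^esub> ?E"
    using assms c by (simp add: gconj_def GH.G.group_simps)
  also have "gconj G (inv\<^bsub>G\<^esub> ?D) (?c \<otimes>\<^bsub>G\<^esub> inv\<^bsub>G\<^esub> ?E)
      = (inv\<^bsub>G\<^esub> ?D \<otimes>\<^bsub>G\<^esub> sw.comm_H h g) \<star>\<^bsub>G\<^esub> z"
    using assms c
    by (simp add: GH.G.mult_star GH.G.inv_star sw.comm_star sw.bracket_star GH.G.gconj_mult)
  finally show ?thesis .
qed

lemma displacement_star:
  assumes u: "u \<in> disp" and z: "z \<in> carrier G"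
  shows "u \<star>\<^bsub>G\<^esub> z \<in> disp"
proof -
  let ?S = "{inv\<^bsub>G\<^esub> (bH h g) \<otimes>\<^bsub>G\<^esub> sw.comm_H h g | h g. h \<in> carrier H \<and> g \<in> carrier G}"
  have S: "?S \<subseteq> carrier G" by auto
  show ?thesis
  proof (rule GH.G.star_generate[of ?S "carrier G" disp])
    show "u \<in> generate G ?S" using u unfolding displacement_alt .
    show "z \<in> generate G (carrier G)" using z by (rule generate.incl)
    show "x \<star>\<^bsub>G\<^esub> y \<in> disp" if "x \<in> ?S" "y \<in> carrier G" for x y
      using that displacement_gen_star by blast
    show "gconj G a m \<in> disp" if "a \<in> generate G ?S" "m \<in> disp" for a m
      using that displacement_gconj GH.G.generate_in_carrier[OF S] by blast
    show "gconj G a m \<in> disp" if "a \<in> generate G (carrier G)" "m \<in> disp" for a m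
      using that displacement_gconj GH.G.generate_in_carrier[of "carrier G"] by blast
  qed (use S displacement_subgroup in auto)
qed

text \<open>Needed because \<open>bH v u\<close> appears when a tensor \<open>u \<otimes> v\<close>
  of the two ideals is starred with a generator. For \<open>v\<close> an inverse generator,
  condition (2) rewrites the bracket as a star in \<open>G\<close>, under which \<open>disp\<close>
  is closed; the other cases are reduced to this kind of star and to conjugation.\<close>

lemma bracket_displacement:
  assumes "v \<in> brs_H"
  shows "u \<in> disp \<Longrightarrow> bH v u \<in> disp"
  using assms[unfolded bracket_subgroup_def]
proof (induction arbitrary: u rule: generate.induct)
  case one
  then show ?case
    using displacement_carrier subgroup.one_closed[OF displacement_subgroup] by simp
next
  case (inv v)
  then obtain x y where xy: "x \<in> carrier G" "y \<in> carrier H" "v = bG x y" by blast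
  have u: "u \<in> carrier G" using inv displacement_carrier by blast
  have "bH (inv\<^bsub>H\<^esub> v) u = inv\<^bsub>G\<^esub> (u \<star>\<^bsub>G\<^esub> bH y x)"
    using xy u by (simp add: sw.bracket_star[symmetric] GH.G.star_antisym[of u])
  then show ?case
    using displacement_star[OF inv.prems] xy subgroup.m_inv_closed[OF displacement_subgroup] by simp
next
  case (incl v)
  then obtain x y where xy: "x \<in> carrier G" "y \<in> carrier H" "v = bG x y" by blast
  have v: "v \<in> brs_H" using xy bracket_mem by simp
  obtain k where k: "k \<in> carrier G" "\<And>g. g \<in> carrier G \<Longrightarrow> aH v g = gconj G k g"
    using bracket_acts_inner[OF v] by metis
  have u: "u \<in> carrier G" using incl displacement_carrier by blast
  have w: "aH v u \<in> disp" using k u displacement_gconj incl.prems by simp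
  have w': "aH v u \<in> carrier G" using w displacement_carrier by blast
  \<comment> \<open>The bracket with \<open>v\<close> is reached through that with its inverse, at
    the cost of moving \<open>u\<close> by \<open>v\<close>, which stays in \<open>disp\<close> as
    \<open>v\<close> acts by an inner automorphism of \<open>G\<close>.\<close>
  have "bH (inv\<^bsub>H\<^esub> v) (aH v u) = inv\<^bsub>G\<^esub> (bH v u)"
    using xy u by (simp add: sw.br_inv_left)
  moreover have "bH (inv\<^bsub>H\<^esub> v) (aH v u) = inv\<^bsub>G\<^esub> (aH v u \<star>\<^bsub>G\<^esub> bH y x)"
    using xy w' by (simp add: sw.bracket_star[symmetric] GH.G.star_antisym[of "aH (bG x y) u"])
  ultimately have "bH v u = aH v u \<star>\<^bsub>G\<^esub> bH y x"
    using xy u w' by (metis GH.G.inv_inv GH.G.star_closed HG.br_closed GH.br_closed)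
  then show ?case
    using displacement_star[OF w] xy by simp
next
  case (eng v v')
  have v: "v \<in> brs_H" "v' \<in> brs_H" using eng.hyps by (simp_all add: bracket_subgroup_def)
  obtain k where k: "k \<in> carrier G" "\<And>g. g \<in> carrier G \<Longrightarrow> aH v g = gconj G k g"
    "\<And>h. h \<in> carrier H \<Longrightarrow> gconj H v h = aG k h"
    using bracket_acts_inner[OF v(1)] by metis
  have u: "u \<in> carrier G" using eng displacement_carrier by blast
  have "bH (v \<otimes>\<^bsub>H\<^esub> v') u = gconj G k (bH v' u) \<otimes>\<^bsub>G\<^esub> bH v u"
    using k u v bracket_carrier by (simp add: HG.br_mult_left compat_equivar_G)
  then show ?case
    using eng k displacement_gconj subgroup.m_closed[OF displacement_subgroup] by simp
qed

end

section \<open>Vanishing of the derived series, for quotients and one step further\<close>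

context mla_ideal_quotient
begin

text \<open>This is the graph of the projection read backwards: total because the projection is
  onto, though a coset is related to each of its representatives. It lifts the derived series of the
  quotient to that of \<open>K\<close>.\<close>

lemma mla_correspondence_quot:
  "mla_correspondence (mla_quot K I) K {(I #> t, t) | t. t \<in> carrier K}"
proof -
  interpret Q: multiplicative_lie_algebra "mla_quot K I" by (rule mla_quot)
  interpret q: group_hom K "mla_quot K I" "\<lambda>x. I #> x"
    by unfold_locales (rule quot_hom)
  show ?thesis
  proof
    fix A d B e
    assume "(A, d) \<in> {(I #> t, t) | t. t \<in> carrier K}" "(B, e) \<in> {(I #> t, t) | t. t \<in> carrier K}"
    then have *: "d \<in> carrier K" "A = I #> d" "e \<in> carrier K" "B = I #> e" by auto
    have "A \<otimes>\<^bsub>mla_quot K I\<^esub> B = I #> (d \<otimes> e)" "A \<star>\<^bsub>mla_quot K I\<^esub> B = I #> (d \<star> e)"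
      using * by (simp_all add: quot_star)
    then show "(A \<otimes>\<^bsub>mla_quot K I\<^esub> B, d \<otimes> e) \<in> {(I #> t, t) | t. t \<in> carrier K}"
      "(A \<star>\<^bsub>mla_quot K I\<^esub> B, d \<star> e) \<in> {(I #> t, t) | t. t \<in> carrier K}"
      using * by auto
  next
    fix A d assume "(A, d) \<in> {(I #> t, t) | t. t \<in> carrier K}"
    then have *: "d \<in> carrier K" "A = I #> d" by auto
    then show "A \<in> carrier (mla_quot K I) \<and> d \<in> carrier K" by (simp add: quot_carrier)
    have "inv\<^bsub>mla_quot K I\<^esub> A = I #> (inv d)" using * by simp
    then show "(inv\<^bsub>mla_quot K I\<^esub> A, inv d) \<in> {(I #> t, t) | t. t \<in> carrier K}"
      using * by auto
  next
    show "(\<one>\<^bsub>mla_quot K I\<^esub>, \<one>) \<in> {(I #> t, t) | t. t \<in> carrier K}"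
      using q.hom_one by auto
  qed (auto simp: quot_carrier)
qed

lemma lie_derived_series_quot_trivial:
  assumes "lie_derived_series K k = {\<one>}"
  shows "lie_derived_series (mla_quot K I) k = {\<one>\<^bsub>mla_quot K I\<^esub>}"
proof -
  interpret Q: multiplicative_lie_algebra "mla_quot K I" by (rule mla_quot)
  interpret q: group_hom K "mla_quot K I" "\<lambda>x. I #> x"
    by unfold_locales (rule quot_hom)
  interpret C: mla_correspondence "mla_quot K I" K "{(I #> t, t) | t. t \<in> carrier K}"
    by (rule mla_correspondence_quot)
  have "\<one>\<^bsub>mla_quot K I\<^esub> \<in> lie_derived_series (mla_quot K I) k"
    using Q.sub_mla_lie_derived_series by (simp add: Q.sub_mla_def subgroup.one_closed)
  moreover have "A = \<one>\<^bsub>mla_quot K I\<^esub>" if A: "A \<in> lie_derived_series (mla_quot K I) k" for A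
  proof -
    obtain d where "d \<in> lie_derived_series K k" "A = I #> d"
      using C.corr_lie_derived_series[OF A] by blast
    then show ?thesis using assms q.hom_one by simp
  qed
  ultimately show ?thesis by blast
qed

end

lemma (in multiplicative_lie_algebra) lie_derived_series_Suc_trivial:
  assumes comm: "\<And>a b. \<lbrakk>a \<in> lie_derived_series K k; b \<in> lie_derived_series K k\<rbrakk> \<Longrightarrow>
    lie_commutator K a b = \<one>"
  shows "lie_derived_series K (Suc k) = {\<one>}"
proof -
  let ?S = "lie_derived_series K k"
  let ?K = "K\<lparr>carrier := ?S\<rparr>"
  interpret S: multiplicative_lie_algebra ?K
    by (rule sub_mla_imp_mla[OF sub_mla_lie_derived_series])
  have "mla_ideal {\<one>} ?K"
    using S.one_is_normal S.star_one by (auto simp: mla_ideal_def)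
  then have "lie_derived ?K \<subseteq> {\<one>}"
    unfolding lie_derived_def mla_genideal_def
    using comm lie_commutator_restrict[OF sub_mla_lie_derived_series] by (intro Inter_lower) auto
  moreover have "\<one> \<in> lie_derived_series K (Suc k)"
    using sub_mla_lie_derived_series by (metis sub_mla_def subgroup.one_closed)
  ultimately show ?thesis by auto
qed

section \<open>The tensor product\<close>

context compatible_mla_actions
begin

interpretation sw: compatible_mla_actions H G aH aG bH bG
  by (rule swap)

abbreviation "T \<equiv> mla_tensor G H aG aH bG bH"
abbreviation "\<tau> \<equiv> tensor_elem G H aG aH bG bH"

sublocale T: multiplicative_lie_algebra T
  unfolding mla_tensor_def by (rule mla_presented_mla)

lemma tensor_elem_class:
  "\<tau> x y = mla_class (carrier G \<times> carrier H) (tensor_rels G H aG aH bG bH) (Gen (x, y))"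
  by (simp add: tensor_elem_def mla_class_def)

lemma tensor_closed [simp]: "\<lbrakk>x \<in> carrier G; y \<in> carrier H\<rbrakk> \<Longrightarrow> \<tau> x y \<in> carrier T"
  by (simp add: tensor_elem_class mla_tensor_def mla_presented_carrier)

lemma tensor_mult_right:
  "\<lbrakk>x \<in> carrier G; y \<in> carrier H; y' \<in> carrier H\<rbrakk> \<Longrightarrow>
    \<tau> x (y \<otimes>\<^bsub>H\<^esub> y') = \<tau> x y \<otimes>\<^bsub>T\<^esub> \<tau> (aH y x) (gconj H y y')"
  by (simp add: tensor_elem_class mla_tensor_def mla_presented_mult tensor_rels.mult_right
      mla_class_eqI mla_cong.rel)

lemma tensor_mult_left:
  "\<lbrakk>x \<in> carrier G; x' \<in> carrier G; y \<in> carrier H\<rbrakk> \<Longrightarrow>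
    \<tau> (x \<otimes>\<^bsub>G\<^esub> x') y = \<tau> (gconj G x x') (aG x y) \<otimes>\<^bsub>T\<^esub> \<tau> x y"
  by (simp add: tensor_elem_class mla_tensor_def mla_presented_mult tensor_rels.mult_left
      mla_class_eqI mla_cong.rel)

lemma tensor_star:
  "\<lbrakk>x \<in> carrier G; x' \<in> carrier G; y \<in> carrier H; y' \<in> carrier H\<rbrakk> \<Longrightarrow>
    \<tau> x y \<star>\<^bsub>T\<^esub> \<tau> x' y' = \<tau> (inv\<^bsub>G\<^esub> (bH y x)) (bG x' y')"
  by (simp add: tensor_elem_class mla_tensor_def mla_presented_star tensor_rels.star_gens
      mla_class_eqI mla_cong.rel)

lemma tensor_one_right [simp]: "x \<in> carrier G \<Longrightarrow> \<tau> x \<one>\<^bsub>H\<^esub> = \<one>\<^bsub>T\<^esub>"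
  using tensor_mult_right[of x "\<one>\<^bsub>H\<^esub>" "\<one>\<^bsub>H\<^esub>"] by simp

lemma tensor_inv_right:
  assumes "x \<in> carrier G" "y \<in> carrier H"
  shows "\<tau> x (inv\<^bsub>H\<^esub> y) = inv\<^bsub>T\<^esub> (\<tau> (aH (inv\<^bsub>H\<^esub> y) x) y)"
  using tensor_mult_right[of x "inv\<^bsub>H\<^esub> y" "y"] assms GH.H.gconj_inv_cancel(1)[of y y]
  by (simp add: T.inv_equality)

lemma tensor_gconj:
  assumes "x \<in> carrier G" "y \<in> carrier H" "g \<in> carrier G" "h \<in> carrier H"
  shows "gconj T (\<tau> x y) (\<tau> g h) = \<tau> (aH (comm_H x y) g) (gconj H (comm_H x y) h)"
  using T.is_group tensor_closed tensor_mult_right tensor_mult_left assms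
  by (rule crossed_pairing_gconj)

text \<open>With \<open>f = bG\<close> the second components are the partners \<open>d\<close> of
  the outline, with \<open>f = comm_H\<close> the partners \<open>e\<close>.\<close>

definition tensor_pairs :: "('a \<Rightarrow> 'b \<Rightarrow> 'b) \<Rightarrow> (('a \<times> 'b) mla_term set \<times> 'b) set" where
  "tensor_pairs f = pair_generate T H {(\<tau> x y, f x y) | x y. x \<in> carrier G \<and> y \<in> carrier H}"

lemma tensor_pairs_induct [consumes 2, case_names gen one mult inv]:
  assumes "(t, d) \<in> tensor_pairs f" and f: "f \<in> carrier G \<rightarrow> carrier H \<rightarrow> carrier H"
    and gen: "\<And>x y. \<lbrakk>x \<in> carrier G; y \<in> carrier H\<rbrakk> \<Longrightarrow> P (\<tau> x y) (f x y)"
    and one: "P \<one>\<^bsub>T\<^esub> \<one>\<^bsub>H\<^esub>"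
    and mult: "\<And>s d t e. \<lbrakk>s \<in> carrier T; d \<in> carrier H; t \<in> carrier T; e \<in> carrier H;
      (s, d) \<in> tensor_pairs f; (t, e) \<in> tensor_pairs f; P s d; P t e\<rbrakk>
      \<Longrightarrow> P (s \<otimes>\<^bsub>T\<^esub> t) (d \<otimes>\<^bsub>H\<^esub> e)"
    and inv: "\<And>s d. \<lbrakk>s \<in> carrier T; d \<in> carrier H; (s, d) \<in> tensor_pairs f; P s d\<rbrakk> \<Longrightarrow>
      P (inv\<^bsub>T\<^esub> s) (inv\<^bsub>H\<^esub> d)"
  shows "P t d"
proof -
  from assms(1)[unfolded tensor_pairs_def] have "t \<in> carrier T \<and> d \<in> carrier H \<and> P t d"
    by (induction rule: pair_generate.induct)
      (use f gen one mult inv in \<open>auto simp: tensor_pairs_def Pi_iff\<close>)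
  then show ?thesis by simp
qed

lemma tensor_pairs_generate:
  assumes "(t, d) \<in> tensor_pairs f" and "f \<in> carrier G \<rightarrow> carrier H \<rightarrow> carrier H"
  shows "t \<in> generate T {\<tau> x y | x y. x \<in> carrier G \<and> y \<in> carrier H}"
  using assms
proof (induction rule: tensor_pairs_induct)
  case (gen x y)
  then show ?case by (blast intro: generate.incl)
next
  case (inv s d)
  show ?case by (rule T.generate_m_inv_closed[OF _ inv(4)]) auto
qed (auto intro: generate.intros)

text \<open>By \<open>star\<close>, the pairs of generators are closed under star, so the group they
  generate is a subalgebra. Totality is then an induction over terms, in which star terms are
  covered by this closure.\<close>

lemma tensor_pairs_correspondence:
  assumes closed: "f \<in> carrier G \<rightarrow> carrier H \<rightarrow> carrier H"
    and star: "\<And>x y x' y'. \<lbrakk>x \<in> carrier G; y \<in> carrier H; x' \<in> carrier G; y' \<in> carrier H\<rbrakk> \<Longrightarrow>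
      f x y \<star>\<^bsub>H\<^esub> f x' y' = f (inv\<^bsub>G\<^esub> (bH y x)) (bG x' y')"
  shows "mla_correspondence T H (tensor_pairs f)"
proof -
  let ?Z = "{(\<tau> x y, f x y) | x y. x \<in> carrier G \<and> y \<in> carrier H}"
  let ?cl = "mla_class (carrier G \<times> carrier H) (tensor_rels G H aG aH bG bH)"
  interpret Z: mla_pair_generators T H ?Z
  proof
    fix s d t e assume "(s, d) \<in> ?Z" "(t, e) \<in> ?Z"
    then obtain x y x' y' where *: "x \<in> carrier G" "y \<in> carrier H" "x' \<in> carrier G" "y' \<in> carrier H"
      "s = \<tau> x y" "d = f x y" "t = \<tau> x' y'" "e = f x' y'" by blast
    then have "s \<star>\<^bsub>T\<^esub> t = \<tau> (inv\<^bsub>G\<^esub> (bH y x)) (bG x' y')"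
      "d \<star>\<^bsub>H\<^esub> e = f (inv\<^bsub>G\<^esub> (bH y x)) (bG x' y')"
      using tensor_star star by simp_all
    moreover have "inv\<^bsub>G\<^esub> (bH y x) \<in> carrier G" "bG x' y' \<in> carrier H" using * by simp_all
    ultimately show "(s \<star>\<^bsub>T\<^esub> t, d \<star>\<^bsub>H\<^esub> e) \<in> ?Z"
      by blast
  qed (use closed in \<open>auto simp: Pi_iff\<close>)
  have "\<exists>d. (?cl t, d) \<in> pair_generate T H ?Z" if "t \<in> mla_terms (carrier G \<times> carrier H)" for t
    using that
  proof (induction t)
    case (Gen p)
    then show ?case
      by (cases p) (auto simp flip: tensor_elem_class intro!: exI pair_generate.base)
  next
    case TOne
    then show ?case
      using pair_generate.one[of T H ?Z] by (auto simp: mla_tensor_def mla_presented_one)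
  next
    case (TMul s t)
    then obtain d e where "(?cl s, d) \<in> pair_generate T H ?Z" "(?cl t, e) \<in> pair_generate T H ?Z"
      by auto
    from pair_generate.mult[OF this] TMul.prems show ?case
      by (auto simp: mla_tensor_def mla_presented_mult)
  next
    case (TInv s)
    then obtain d where "(?cl s, d) \<in> pair_generate T H ?Z"
      by auto
    from pair_generate.inv[OF this] TInv.prems show ?case
      by (auto simp: mla_tensor_def mla_presented_inv)
  next
    case (TStar s t)
    then obtain d e where "(?cl s, d) \<in> pair_generate T H ?Z" "(?cl t, e) \<in> pair_generate T H ?Z"
      by auto
    from Z.pair_star[OF this] TStar.prems show ?case
      by (auto simp: mla_tensor_def mla_presented_star)
  qed
  then have "\<exists>d. (t, d) \<in> pair_generate T H ?Z" if "t \<in> carrier T" for t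
    using that by (auto simp: mla_tensor_def mla_presented_carrier)
  then show ?thesis
    unfolding tensor_pairs_def by (rule Z.mla_correspondence_pair_generate)
qed

lemma br_funcset: "bG \<in> carrier G \<rightarrow> carrier H \<rightarrow> carrier H"
  and comm_H_funcset: "comm_H \<in> carrier G \<rightarrow> carrier H \<rightarrow> carrier H"
  by simp_all

sublocale brp: mla_correspondence T H "tensor_pairs bG"
  by (rule tensor_pairs_correspondence[OF br_funcset]) (simp add: bracket_star)

sublocale cop: mla_correspondence T H "tensor_pairs comm_H"
  by (rule tensor_pairs_correspondence[OF comm_H_funcset]) (simp add: comm_star_comm)

lemma tensor_generated:
  "t \<in> carrier T \<Longrightarrow> t \<in> generate T {\<tau> x y | x y. x \<in> carrier G \<and> y \<in> carrier H}"
  using brp.corr_total tensor_pairs_generate br_funcset by blast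

section \<open>Conjugation and star in the tensor product, expressed through partners\<close>

lemma comm_pair_gconj:
  assumes "(t, d) \<in> tensor_pairs comm_H"
  shows "\<lbrakk>x \<in> carrier G; y \<in> carrier H\<rbrakk> \<Longrightarrow> gconj T t (\<tau> x y) = \<tau> (aH d x) (gconj H d y)"
  using assms comm_H_funcset
proof (induction arbitrary: x y rule: tensor_pairs_induct)
  case (gen x' y')
  then show ?case by (simp add: tensor_gconj)
next
  case (mult s d t e)
  then show ?case by (simp add: T.gconj_comp HG.act_comp GH.H.gconj_comp)
next
  case (inv s d)
  let ?x = "aH (inv\<^bsub>H\<^esub> d) x" and ?y = "gconj H (inv\<^bsub>H\<^esub> d) y"
  have "gconj T s (\<tau> ?x ?y) = \<tau> x y" using inv by simp
  moreover have "\<tau> ?x ?y \<in> carrier T" using inv by simp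
  ultimately show ?case using inv T.gconj_inv_cancel(1) by metis
qed simp

text \<open>Meant for normal subgroups of \<open>G\<close> such as \<open>disp\<close>, which the
  partners therefore preserve. A generator contributes \<open>comm_G x y\<close>, the same
  commutator read in \<open>G\<close>.\<close>

lemma comm_pair_inner:
  assumes "(t, d) \<in> tensor_pairs comm_H"
  shows "\<exists>k\<in>carrier G. \<forall>g\<in>carrier G. aH d g = gconj G k g"
  using assms comm_H_funcset
proof (induction rule: tensor_pairs_induct)
  case (gen x y)
  then show ?case by (intro bexI[of _ "comm_G x y"]) (simp_all add: comm_G_act_G)
next
  case one
  show ?case by (rule bexI[of _ "\<one>\<^bsub>G\<^esub>"]) simp_all
next
  case (mult s d t e)
  then obtain k k' where "k \<in> carrier G" "k' \<in> carrier G"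
    "\<forall>g\<in>carrier G. aH d g = gconj G k g" "\<forall>g\<in>carrier G. aH e g = gconj G k' g"
    by blast
  then show ?case
    using mult by (intro bexI[of _ "k \<otimes>\<^bsub>G\<^esub> k'"]) (simp_all add: HG.act_comp GH.G.gconj_comp)
next
  case (inv s d)
  then obtain k where k: "k \<in> carrier G" "\<forall>g\<in>carrier G. aH d g = gconj G k g"
    by blast
  have "aH (inv\<^bsub>H\<^esub> d) g = gconj G (inv\<^bsub>G\<^esub> k) g" if "g \<in> carrier G" for g
    using k inv that HG.act_inv_cancel(1)[of d "gconj G (inv\<^bsub>G\<^esub> k) g"] by simp
  then show ?case using k by (intro bexI[of _ "inv\<^bsub>G\<^esub> k"]) simp_all
qed

text \<open>This is \<open>bracket_gconj_comm\<close> with \<open>G\<close> and \<open>H\<close>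
  exchanged, for inverses: \<open>comm_G x y\<close> is the inverse of the exchanged commutator
  \<open>?p\<close>, so the exchanged lemma is applied to \<open>?g\<close>, which \<open>?p\<close>
  carries to \<open>g\<close>.\<close>

lemma comm_act_bracket:
  assumes x: "x \<in> carrier G" and y: "y \<in> carrier H" and g: "g \<in> brs_G"
  shows "aH (comm_H x y) g = aH (bG x y) g"
proof -
  have gG: "g \<in> carrier G" using g sw.bracket_carrier by blast
  let ?p = "sw.comm_H y x"
  have p: "?p \<in> carrier G" using x y by simp
  have cG: "comm_G x y = inv\<^bsub>G\<^esub> ?p"
    using x y by (simp add: comm_G_def sw.comm_H_def GH.G.inv_mult_group HG.act_inv)
  let ?g = "gconj G (inv\<^bsub>G\<^esub> ?p) g"
  have "?g \<in> brs_G"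
    using g p GH.G.normal_gconj_closed[OF sw.bracket_normal] by simp
  then have "gconj G (bH y x) ?g = gconj G ?p ?g"
    using x y by (intro sw.bracket_gconj_comm)
  also have "\<dots> = g"
    using p gG by simp
  finally have "?g = gconj G (inv\<^bsub>G\<^esub> (bH y x)) g"
    using x y p gG by (metis GH.G.gconj_inv_cancel(1) GH.G.gconj_closed GH.G.inv_closed HG.br_closed)
  then show ?thesis
    using x y gG cG by (simp add: bracket_gconj flip: comm_G_act_G)
qed

text \<open>On tensors with entries in \<open>brs_G\<close> and \<open>brs_H\<close> the commutator
  in \<open>tensor_gconj\<close> may be replaced by the bracket. Membership of \<open>d\<close> in
  \<open>brs_H\<close> is carried along because it makes \<open>d\<close> act on \<open>G\<close> by
  an inner automorphism, which keeps \<open>brs_G\<close> stable.\<close>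

lemma bracket_pair_gconj:
  assumes "(t, d) \<in> tensor_pairs bG"
  shows "d \<in> brs_H \<and> (\<forall>g\<in>brs_G. \<forall>h\<in>brs_H. gconj T t (\<tau> g h) = \<tau> (aH d g) (gconj H d h))"
  using assms br_funcset
proof (induction rule: tensor_pairs_induct)
  case (gen x y)
  then show ?case
    using bracket_carrier sw.bracket_carrier
    by (simp add: bracket_mem tensor_gconj comm_act_bracket bracket_gconj_comm)
next
  case one
  show ?case
    using bracket_carrier sw.bracket_carrier subgroup.one_closed[OF bracket_subgroup] by simp
next
  case (mult s d t e)
  have "aH e g \<in> brs_G" if g: "g \<in> brs_G" for g
    using g mult bracket_acts_inner[of e] GH.G.normal_gconj_closed[OF sw.bracket_normal]
      sw.bracket_carrier by metis
  moreover have "gconj H e h \<in> brs_H" if "h \<in> brs_H" for h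
    using that mult GH.H.normal_gconj_closed[OF bracket_normal] by blast
  ultimately show ?case
    using mult bracket_carrier sw.bracket_carrier subgroup.m_closed[OF bracket_subgroup]
    by (simp add: T.gconj_comp HG.act_comp GH.H.gconj_comp)
next
  case (inv s d)
  have d: "inv\<^bsub>H\<^esub> d \<in> brs_H"
    using inv subgroup.m_inv_closed[OF bracket_subgroup] by blast
  have "gconj T (inv\<^bsub>T\<^esub> s) (\<tau> g h) = \<tau> (aH (inv\<^bsub>H\<^esub> d) g) (gconj H (inv\<^bsub>H\<^esub> d) h)"
    if g: "g \<in> brs_G" and h: "h \<in> brs_H" for g h
  proof -
    let ?g = "aH (inv\<^bsub>H\<^esub> d) g" and ?h = "gconj H (inv\<^bsub>H\<^esub> d) h"
    have "?g \<in> brs_G"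
      using g bracket_acts_inner[OF d] GH.G.normal_gconj_closed[OF sw.bracket_normal]
        sw.bracket_carrier by metis
    moreover have "?h \<in> brs_H"
      using h inv GH.H.normal_gconj_closed[OF bracket_normal] by simp
    ultimately have "gconj T s (\<tau> ?g ?h) = \<tau> g h" and "\<tau> ?g ?h \<in> carrier T"
      using inv g h bracket_carrier sw.bracket_carrier by simp_all
    then show ?thesis using inv T.gconj_inv_cancel(1) by metis
  qed
  then show ?case using d by blast
qed

text \<open>Star is a crossed homomorphism in \<open>t\<close>, and so is the tensor in its right
  entry. The twists agree by \<open>bracket_pair_gconj\<close>, which applies since the left entry
  \<open>?g\<close> lies in \<open>brs_G\<close> and the partners lie in
  \<open>brs_H\<close>.\<close>

lemma bracket_pair_star:
  assumes x: "x \<in> carrier G" and y: "y \<in> carrier H" and "(t, d) \<in> tensor_pairs bG"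
  shows "\<tau> x y \<star>\<^bsub>T\<^esub> t = \<tau> (inv\<^bsub>G\<^esub> (bH y x)) d"
proof -
  let ?g = "inv\<^bsub>G\<^esub> (bH y x)"
  have g: "?g \<in> brs_G" "?g \<in> carrier G"
    using x y sw.bracket_mem subgroup.m_inv_closed[OF sw.bracket_subgroup] by simp_all
  show ?thesis
    using assms(3) br_funcset
  proof (induction rule: tensor_pairs_induct)
    case (gen x' y')
    then show ?case using x y by (simp add: tensor_star)
  next
    case one
    then show ?case using x y by simp
  next
    case (mult s d t e)
    then have "gconj T s (\<tau> ?g e) = \<tau> (aH d ?g) (gconj H d e)"
      using g bracket_pair_gconj by blast
    then show ?case
      using x y g mult by (simp add: T.star_mult tensor_mult_right)
  next
    case (inv s d)
    have d: "d \<in> brs_H" using inv bracket_pair_gconj by blast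
    have "(inv\<^bsub>T\<^esub> s, inv\<^bsub>H\<^esub> d) \<in> tensor_pairs bG" using inv by (simp add: brp.corr_inv)
    then have "gconj T (inv\<^bsub>T\<^esub> s) (\<tau> ?g d) = \<tau> (aH (inv\<^bsub>H\<^esub> d) ?g) (gconj H (inv\<^bsub>H\<^esub> d) d)"
      using g d bracket_pair_gconj by blast
    also have "gconj H (inv\<^bsub>H\<^esub> d) d = d"
      using inv GH.H.gconj_inv_cancel(1)[of d d] by simp
    finally show ?case
      using x y g inv by (simp add: T.star_inv T.gconj_inv tensor_inv_right)
  qed
qed

text \<open>Each partner settles one factor: the trivial commutator partner makes \<open>a\<close>
  central, and the trivial bracket partner makes every generator star \<open>b\<close> a tensor with
  right entry \<open>\<one>\<close>.\<close>

lemma tensor_lie_commutator_trivial: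
  assumes a: "(a, \<one>\<^bsub>H\<^esub>) \<in> tensor_pairs comm_H" and b: "(b, \<one>\<^bsub>H\<^esub>) \<in> tensor_pairs bG"
  shows "lie_commutator T a b = \<one>\<^bsub>T\<^esub>"
proof -
  let ?Z = "{\<tau> x y | x y. x \<in> carrier G \<and> y \<in> carrier H}"
  have Z: "?Z \<subseteq> carrier T" by auto
  have ab: "a \<in> carrier T" "b \<in> carrier T" using a b cop.corr_sub brp.corr_sub by blast+
  have "gconj T a s = s" if "s \<in> carrier T" for s
    using tensor_generated[OF that]
  proof (induction rule: generate.induct)
    case (incl h)
    then show ?case using comm_pair_gconj[OF a] by auto
  next
    case (inv h)
    then show ?case using comm_pair_gconj[OF a] ab by (auto simp: T.gconj_inv)
  next
    case (eng h1 h2)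
    then show ?case using ab T.generate_in_carrier[OF Z] by (simp add: T.gconj_mult)
  qed (use ab in simp)
  then have "gcomm T a b = \<one>\<^bsub>T\<^esub>"
    using ab by (simp add: T.gcomm_eq)
  moreover have "a \<star>\<^bsub>T\<^esub> b \<in> {\<one>\<^bsub>T\<^esub>}"
  \<comment> \<open>With the trivial subgroup as \<open>M\<close>, vanishing passes from the
    generators to all words in them.\<close>
  proof (rule T.star_generate[of ?Z "{b}"])
    show "a \<in> generate T ?Z" by (rule tensor_generated[OF ab(1)])
    show "b \<in> generate T {b}" by (rule generate.incl) simp
    show "x \<star>\<^bsub>T\<^esub> y \<in> {\<one>\<^bsub>T\<^esub>}" if "x \<in> ?Z" "y \<in> {b}" for x y
      using that bracket_pair_star[OF _ _ b] by auto
    show "gconj T c m \<in> {\<one>\<^bsub>T\<^esub>}" if "c \<in> generate T ?Z" "m \<in> {\<one>\<^bsub>T\<^esub>}" for c m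
      using that T.generate_in_carrier[OF Z] by simp
    show "gconj T c m \<in> {\<one>\<^bsub>T\<^esub>}" if "c \<in> generate T {b}" "m \<in> {\<one>\<^bsub>T\<^esub>}" for c m
      using that T.generate_in_carrier[of "{b}"] ab by simp
    show "subgroup {\<one>\<^bsub>T\<^esub>} T" by (rule T.triv_subgroup)
  qed (use Z ab in auto)
  ultimately show ?thesis by (simp add: lie_commutator_def)
qed

lemma tensor_lie_derived_series_trivial:
  assumes "lie_derived_series H n = {\<one>\<^bsub>H\<^esub>}"
  shows "lie_derived_series T (Suc n) = {\<one>\<^bsub>T\<^esub>}"
proof (rule T.lie_derived_series_Suc_trivial)
  fix a b assume "a \<in> lie_derived_series T n" "b \<in> lie_derived_series T n"
  then show "lie_commutator T a b = \<one>\<^bsub>T\<^esub>"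
    using cop.corr_lie_derived_series[of a n] brp.corr_lie_derived_series[of b n] assms
    by (intro tensor_lie_commutator_trivial) auto
qed

text \<open>Conjugation by \<open>t\<close> moves both entries by a commutator partner, which acts
  on \<open>G\<close> by an inner automorphism and on \<open>H\<close> by conjugation, so both
  normal subgroups are respected. Stars reduce to generators by
  \<open>star_generate\<close>.\<close>

lemma tensor_ideal: "mla_ideal (ideal_tensor G H aG aH bG bH disp brs_H) T"
proof -
  let ?Y = "{\<tau> a b | a b. a \<in> disp \<and> b \<in> brs_H}"
  let ?N = "generate T ?Y"
  let ?Z = "{\<tau> x y | x y. x \<in> carrier G \<and> y \<in> carrier H}"
  have Y: "?Y \<subseteq> carrier T" and Z: "?Z \<subseteq> carrier T"
    using displacement_carrier bracket_carrier by auto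
  have normal: "?N \<lhd> T"
  proof (rule T.normal_generateI[OF Y])
    fix w t assume "w \<in> ?Y" and t: "t \<in> carrier T"
    then obtain a b where ab: "a \<in> disp" "b \<in> brs_H" "w = \<tau> a b" by blast
    obtain d where d: "(t, d) \<in> tensor_pairs comm_H" using cop.corr_total t by blast
    obtain k where k: "k \<in> carrier G" "\<forall>g\<in>carrier G. aH d g = gconj G k g"
      using comm_pair_inner[OF d] by blast
    have "gconj T t w = \<tau> (aH d a) (gconj H d b)"
      using ab displacement_carrier bracket_carrier comm_pair_gconj[OF d] by simp
    moreover have "aH d a \<in> disp"
      using ab k displacement_carrier displacement_gconj by simp
    moreover have "gconj H d b \<in> brs_H"
      using ab cop.corr_sub[OF d] GH.H.normal_gconj_closed[OF bracket_normal] by simp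
    ultimately show "t \<otimes>\<^bsub>T\<^esub> w \<otimes>\<^bsub>T\<^esub> inv\<^bsub>T\<^esub> t \<in> ?Y"
      unfolding gconj_def by blast
  qed
  have sub: "subgroup ?N T" by (rule normal_imp_subgroup[OF normal])
  have "t \<star>\<^bsub>T\<^esub> w \<in> ?N" if t: "t \<in> carrier T" and w: "w \<in> ?N" for t w
  proof (rule T.star_generate[OF Z Y sub])
    show "x \<star>\<^bsub>T\<^esub> y \<in> ?N" if xy: "x \<in> ?Z" "y \<in> ?Y" for x y
    proof -
      from xy obtain a b u v where *: "a \<in> carrier G" "b \<in> carrier H" "x = \<tau> a b"
        "u \<in> disp" "v \<in> brs_H" "y = \<tau> u v" by blast
      have uv: "u \<in> carrier G" "v \<in> carrier H" using * displacement_carrier bracket_carrier by auto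
      \<comment> \<open>The star is computed in the reversed order \<open>y\<close>,
        \<open>x\<close>, which puts the bracket of \<open>v\<close> and \<open>u\<close> on the
        left, where \<open>bracket_displacement\<close> applies; antisymmetry restores the
        order.\<close>
      have "inv\<^bsub>G\<^esub> (bH v u) \<in> disp"
        using * bracket_displacement subgroup.m_inv_closed[OF displacement_subgroup] by simp
      then have "\<tau> (inv\<^bsub>G\<^esub> (bH v u)) (bG a b) \<in> ?N"
        using * bracket_mem by (blast intro: generate.incl)
      then have "y \<star>\<^bsub>T\<^esub> x \<in> ?N"
        using * uv by (simp add: tensor_star)
      then show ?thesis
        using * uv T.star_antisym[of y x] subgroup.m_inv_closed[OF sub] by simp
    qed
    show "t \<in> generate T ?Z" by (rule tensor_generated[OF t])
    show "gconj T c m \<in> ?N" if "c \<in> generate T ?Z" "m \<in> ?N" for c m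
      using that T.generate_in_carrier[OF Z] T.normal_gconj_closed[OF normal] by blast
    show "gconj T c m \<in> ?N" if "c \<in> ?N" "m \<in> ?N" for c m
      using that T.generate_in_carrier[OF Y] T.normal_gconj_closed[OF normal] by blast
  qed (rule w)
  with normal show ?thesis
    by (simp add: mla_ideal_def ideal_tensor_def)
qed

end

section \<open>Solvability and length of the quotient\<close>

theorem mainTheorem2:
  fixes G :: "('a, 'm) mla_scheme" and H :: "('b, 'k) mla_scheme"
    and aG :: "'a \<Rightarrow> 'b \<Rightarrow> 'b" and aH :: "'b \<Rightarrow> 'a \<Rightarrow> 'a"
    and bG :: "'a \<Rightarrow> 'b \<Rightarrow> 'b" and bH :: "'b \<Rightarrow> 'a \<Rightarrow> 'a" and n :: nat
  assumes "compatible_mla_actions G H aG aH bG bH"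
    and "lie_solvable H" and "lie_length H = n"
  shows "let T = mla_tensor G H aG aH bG bH;
             N = ideal_tensor G H aG aH bG bH (lie_displacement G H aH bH) (bracket_subgroup G H bG);
             Q = mla_quot T N
         in mla_ideal N T \<and> multiplicative_lie_algebra Q \<and> lie_solvable Q \<and> lie_length Q \<le> n + 1"
proof -
  interpret compatible_mla_actions G H aG aH bG bH by fact
  let ?N = "ideal_tensor G H aG aH bG bH disp brs_H"
  interpret Q: mla_ideal_quotient T ?N
    by unfold_locales (rule tensor_ideal)
  \<comment> \<open>Solvability of \<open>H\<close> guarantees that the \<open>LEAST\<close> in
    \<open>lie_length\<close> is attained.\<close>
  have "lie_derived_series H n = {\<one>\<^bsub>H\<^esub>}"
    using assms(2,3) unfolding lie_solvable_def lie_length_def by (metis (mono_tags, lifting) LeastI_ex)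
  then have "lie_derived_series (mla_quot T ?N) (Suc n) = {\<one>\<^bsub>mla_quot T ?N\<^esub>}"
    by (intro Q.lie_derived_series_quot_trivial tensor_lie_derived_series_trivial)
  then have "lie_solvable (mla_quot T ?N)" "lie_length (mla_quot T ?N) \<le> n + 1"
    unfolding lie_solvable_def lie_length_def by (auto intro!: Least_le simp del: lie_derived_series.simps)
  then show ?thesis
    using tensor_ideal Q.mla_quot by (simp add: Let_def)
qed

end
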